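(* For $i=1,2$ let $s_i\in\mathbb Z_+$ and let $\psi^{(i)}\in\mathcal D_{s_i}(\mathbb R^{n_i})$, $\varphi^{(i)}\in\mathcal S(\mathbb R^{n_i})$ satisfy conditions (i)–(iv) below. Let $0<\sigma_i<\sigma_i'<n_i+s_i+1$ for $i=1,2$. Then for every $f\in\mathcal D_{s_1,s_2}(\mathbb R^{n_1}\times\mathbb R^{n_2})$ there exists $C>0$ such that for all $\epsilon_1,\epsilon_2\in(0,1)$ and $L_1,L_2\in(1,\infty)$, $$\sup_{(x_1,x_2)}(1+|x_1|)^{\sigma_1}(1+|x_2|)^{\sigma_2}\Big(\int_0^{\epsilon_1}\!\!\int_0^\infty+\int_{L_1}^\infty\!\!\int_0^\infty+\int_0^\infty\!\!\int_0^{\epsilon_2}+\int_0^\infty\!\!\int_{L_2}^\infty\Big)\int_{\mathbb R^{n_1}\times\mathbb R^{n_2}}|(\varphi_{t_1,t_2}*f)(y_1,y_2)||\psi_{t_1,t_2}(x_1-y_1,x_2-y_2)|\,dy_1dy_2\frac{dt_2}{t_2}\frac{dt_1}{t_1}$$ $$\le C[\epsilon_1+\epsilon_2+L_1^{\sigma_1-n_1-s_1-1}+L_2^{\sigma_2-n_2-s_2-1}]$$ (in each double integral the outer variable is $t_1$ and the inner is $t_2$), and $$\sup_{(x_1,x_2)}(1+|x_1|)^{\sigma_1}(1+|x_2|)^{\sigma_2}\int_0^{L_1}\!\!\int_0^\infty\int_{\{|y_1|\ge 2L_1\}\times\mathbb R^{n_2}}|(\varphi_{t_1,t_2}*f)(y_1,y_2)||\psi_{t_1,t_2}(x_1-y_1,x_2-y_2)|\,dy_1dy_2\frac{dt_2}{t_2}\frac{dt_1}{t_1}\le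 CL_1^{\sigma_1-\sigma_1'},$$ and the analogous estimate holds with the roles of the two variables interchanged (i.e. $\int_0^\infty\int_0^{L_2}$ over $t_1,t_2$, region $\mathbb R^{n_1}\times\{|y_2|\ge2L_2\}$, bound $CL_2^{\sigma_2-\sigma_2'}$).
   Context: $\mathcal D_{s}(\mathbb R^{k})$ is the set of smooth compactly supported functions on $\mathbb R^k$ with vanishing moments $\int\psi(x)x^\alpha dx=0$ for $|\alpha|\le s$. $\mathcal D_{s_1,s_2}(\mathbb R^{n_1}\times\mathbb R^{n_2})$ is the set of smooth compactly supported $f$ with $\int_{\mathbb R^{n_1}}f(x_1,x_2)x_1^{\alpha_1}dx_1=0$ for all $x_2$, $|\alpha_1|\le s_1$, and $\int_{\mathbb R^{n_2}}f(x_1,x_2)x_2^{\alpha_2}dx_2=0$ for all $x_1$, $|\alpha_2|\le s_2$. Conditions for $i=1,2$: (i) $\operatorname{supp}\psi^{(i)}\subset\{|x_i|<1\}$, $\widehat{\psi^{(i)}}\ge0$ and $\widehat{\psi^{(i)}}(\xi_i)\ge1/2$ for $1/2\le|\xi_i|\le2$; (ii) $\operatorname{supp}\widehat{\varphi^{(i)}}\subset\{1/2\le|\xi_i|\le2\}$ and $\widehat{\varphi^{(i)}}\ge0$; (iii) $\sup\{\widehat{\varphi^{(i)}}(\xi_i):3/5\le|\xi_i|\le5/3\}>0$; (iv) $\int_0^\infty\widehat{\psi^{(i)}}(t\xi_i)\widehat{\varphi^{(i)}}(t\xi_i)\frac{dt}{t}=1$ for all $\xi_i\ne0$. Here $\widehat{\cdot}$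 is the Fourier transform, $\phi^{(i)}_{t_i}(x_i)=t_i^{-n_i}\phi^{(i)}(x_i/t_i)$, $\phi_{t_1,t_2}(x_1,x_2)=\phi^{(1)}_{t_1}(x_1)\phi^{(2)}_{t_2}(x_2)$, and $*$ is convolution on $\mathbb R^{n_1}\times\mathbb R^{n_2}$. *)

theory Defs
  imports "HOL-Analysis.Analysis"
begin

fun dderiv :: "'a::real_normed_vector list \<Rightarrow> ('a \<Rightarrow> 'b::real_normed_vector) \<Rightarrow> 'a \<Rightarrow> 'b" where
  "dderiv [] f = f"
| "dderiv (v # vs) f = (\<lambda>x. frechet_derivative (dderiv vs f) (at x) v)"

definition smooth_fun :: "('a::real_normed_vector \<Rightarrow> 'b::real_normed_vector) \<Rightarrow> bool" where
  "smooth_fun f \<longleftrightarrow> (\<forall>vs x. dderiv vs f differentiable (at x))"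

definition compact_supp :: "('a::real_normed_vector \<Rightarrow> 'b::zero) \<Rightarrow> bool" where
  "compact_supp f \<longleftrightarrow> compact (closure {x. f x \<noteq> 0})"

definition schwartz :: "('a::real_normed_vector \<Rightarrow> 'b::real_normed_vector) \<Rightarrow> bool" where
  "schwartz f \<longleftrightarrow> smooth_fun f \<and>
     (\<forall>vs (k::nat). bounded (range (\<lambda>x. (1 + norm x) ^ k * norm (dderiv vs f x))))"

definition monom :: "('n::finite \<Rightarrow> nat) \<Rightarrow> real^'n \<Rightarrow> real" where
  "monom \<alpha> x = (\<Prod>i\<in>UNIV. (x $ i) ^ \<alpha> i)"

definition mdeg :: "('n::finite \<Rightarrow> nat) \<Rightarrow> nat" where
  "mdeg \<alpha> = (\<Sum>i\<in>UNIV. \<alpha> i)"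

definition Dspace :: "nat \<Rightarrow> (real^'n::finite \<Rightarrow> complex) set" where
  "Dspace s = {\<psi>. smooth_fun \<psi> \<and> compact_supp \<psi> \<and>
     (\<forall>\<alpha>. mdeg \<alpha> \<le> s \<longrightarrow> (\<integral>x. \<psi> x * of_real (monom \<alpha> x) \<partial>lborel) = 0)}"

definition Dspace2 :: "nat \<Rightarrow> nat \<Rightarrow> ((real^'n1::finite) \<times> (real^'n2::finite) \<Rightarrow> complex) set" where
  "Dspace2 s1 s2 = {f. smooth_fun f \<and> compact_supp f \<and>
     (\<forall>x2 \<alpha>1. mdeg \<alpha>1 \<le> s1 \<longrightarrow> (\<integral>x1. f (x1, x2) * of_real (monom \<alpha>1 x1) \<partial>lborel) = 0) \<and>
     (\<forall>x1 \<alpha>2. mdeg \<alpha>2 \<le> s2 \<longrightarrow> (\<integral>x2. f (x1, x2) * of_real (monom \<alpha>2 x2) \<partial>lborel) = 0)}"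

definition fourier :: "(real^'n::finite \<Rightarrow> complex) \<Rightarrow> real^'n \<Rightarrow> complex" where
  "fourier f \<xi> = (\<integral>x. f x * cis (- 2 * pi * (x \<bullet> \<xi>)) \<partial>lborel)"

definition dil :: "real \<Rightarrow> (real^'n::finite \<Rightarrow> complex) \<Rightarrow> real^'n \<Rightarrow> complex" where
  "dil t \<phi> x = of_real (1 / t ^ CARD('n)) * \<phi> ((1 / t) *\<^sub>R x)"

definition dil2 :: "real \<Rightarrow> real \<Rightarrow> (real^'n1::finite \<Rightarrow> complex) \<Rightarrow> (real^'n2::finite \<Rightarrow> complex)
    \<Rightarrow> (real^'n1) \<times> (real^'n2) \<Rightarrow> complex" where
  "dil2 t1 t2 \<phi>1 \<phi>2 x = dil t1 \<phi>1 (fst x) * dil t2 \<phi>2 (snd x)"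

definition conv :: "('a::euclidean_space \<Rightarrow> complex) \<Rightarrow> ('a \<Rightarrow> complex) \<Rightarrow> 'a \<Rightarrow> complex" where
  "conv g f y = (\<integral>z. g (y - z) * f z \<partial>lborel)"

definition cond_pair :: "(real^'n::finite \<Rightarrow> complex) \<Rightarrow> (real^'n \<Rightarrow> complex) \<Rightarrow> bool" where
  "cond_pair \<psi> \<phi> \<longleftrightarrow>
     \<comment> \<open>(i)\<close>
     closure {x. \<psi> x \<noteq> 0} \<subseteq> ball 0 1 \<and>
     (\<forall>\<xi>. Im (fourier \<psi> \<xi>) = 0 \<and> Re (fourier \<psi> \<xi>) \<ge> 0) \<and>
     (\<forall>\<xi>. 1/2 \<le> norm \<xi> \<and> norm \<xi> \<le> 2 \<longrightarrow> Re (fourier \<psi> \<xi>) \<ge> 1/2) \<and>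
     \<comment> \<open>(ii)\<close>
     closure {\<xi>. fourier \<phi> \<xi> \<noteq> 0} \<subseteq> {\<xi>. 1/2 \<le> norm \<xi> \<and> norm \<xi> \<le> 2} \<and>
     (\<forall>\<xi>. Im (fourier \<phi> \<xi>) = 0 \<and> Re (fourier \<phi> \<xi>) \<ge> 0) \<and>
     \<comment> \<open>(iii)\<close>
     (\<exists>\<xi>. 3/5 \<le> norm \<xi> \<and> norm \<xi> \<le> 5/3 \<and> Re (fourier \<phi> \<xi>) > 0) \<and>
     \<comment> \<open>(iv)\<close>
     (\<forall>\<xi>. \<xi> \<noteq> 0 \<longrightarrow>
        (LINT t:{0<..}|lborel. Re (fourier \<psi> (t *\<^sub>R \<xi>)) * Re (fourier \<phi> (t *\<^sub>R \<xi>)) / t) = 1)"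

definition Qint :: "(real^'n1::finite \<Rightarrow> complex) \<Rightarrow> (real^'n2::finite \<Rightarrow> complex) \<Rightarrow>
    (real^'n1 \<Rightarrow> complex) \<Rightarrow> (real^'n2 \<Rightarrow> complex) \<Rightarrow> ((real^'n1) \<times> (real^'n2) \<Rightarrow> complex) \<Rightarrow>
    real set \<Rightarrow> real set \<Rightarrow> ((real^'n1) \<times> (real^'n2)) set \<Rightarrow> (real^'n1) \<times> (real^'n2) \<Rightarrow> ennreal" where
  "Qint \<psi>1 \<psi>2 \<phi>1 \<phi>2 f A1 A2 Y x =
     (\<integral>\<^sup>+ t1\<in>A1. (\<integral>\<^sup>+ t2\<in>A2.
        (\<integral>\<^sup>+ y\<in>Y. ennreal (norm (conv (dil2 t1 t2 \<phi>1 \<phi>2) f y) * norm (dil2 t1 t2 \<psi>1 \<psi>2 (x - y))) \<partial>lborel)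
        * ennreal (1 / t2) \<partial>lborel) * ennreal (1 / t1) \<partial>lborel)"

definition weight :: "real \<Rightarrow> real \<Rightarrow> (real^'n1::finite) \<times> (real^'n2::finite) \<Rightarrow> real" where
  "weight \<sigma>1 \<sigma>2 x = (1 + norm (fst x)) powr \<sigma>1 * (1 + norm (snd x)) powr \<sigma>2"

end

theory Submission
  imports Defs
begin

text \<open>
  Everything follows from the pointwise bound
  \<open>\<bar>(\<phi>\<^bsub>t1,t2\<^esub> * f)(y1, y2)\<bar> \<le> C k1(t1, y1) k2(t2, y2)\<close>, where
  \<open>k(t, y) = min t 1 / (max 1 t + \<bar>y\<bar>)\<^bsup>n+s+1\<^esup>\<close>.
  In one variable, for \<open>t \<le> 1\<close> the mean of \<open>\<phi>\<close> vanishes (its Fourier transform is zero at the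
  origin) and one gains a factor \<open>t\<close> from the Lipschitz bound on the function convolved with it; for
  \<open>t \<ge> 1\<close> the vanishing moments of that function allow subtracting the Taylor polynomial of
  \<open>\<phi>\<^bsub>t\<^esub>\<close> of degree \<open>s\<close>. The one-variable bound is linear in the sup and Lipschitz norms of the
  function, so it can be applied first to the slices \<open>f(z1, \<cdot>)\<close> and their increments in \<open>z1\<close>, and then
  to the resulting function of \<open>z1\<close>.

  On the support of \<open>\<psi>\<^bsub>t\<^esub>(x - y)\<close> one has \<open>\<bar>x - y\<bar> < t\<close>, hence
  \<open>(1 + \<bar>x\<bar>)\<^bsup>\<tau>\<^esup> k(t, y) \<le> 2\<^bsup>n+s+1\<^esup> min t 1 (max 1 t)\<^bsup>\<tau>-n-s-1\<^esup>\<close> for \<open>0 \<le> \<tau> \<le> n+s+1\<close>, and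
  the four integrals are products of elementary integrals in \<open>t1\<close> and \<open>t2\<close> (with \<open>\<tau> = \<sigma>\<close>). For the
  last two estimates take \<open>\<tau> = \<sigma>'\<close> and note that \<open>\<bar>y\<bar> \<ge> 2L\<close> and \<open>t < L\<close> force \<open>\<bar>x\<bar> \<ge> L\<close>.
\<close>

section \<open>Directional derivatives and Taylor expansion\<close>

lemma dderiv_append: "dderiv vs (dderiv ws f) = dderiv (vs @ ws) f"
  by (induction vs) auto

lemma smooth_fun_dderiv: "smooth_fun f \<Longrightarrow> smooth_fun (dderiv ws f)"
  by (simp add: smooth_fun_def dderiv_append)

lemma smooth_fun_differentiable: "smooth_fun f \<Longrightarrow> f differentiable (at x)"
  unfolding smooth_fun_def by (metis dderiv.simps(1))

lemma smooth_fun_continuous_on: "smooth_fun f \<Longrightarrow> continuous_on S f"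
  by (meson continuous_at_imp_continuous_on differentiable_imp_continuous_within
      smooth_fun_differentiable)

lemma frechet_derivative_Basis_expansion:
  fixes f :: "'a::euclidean_space \<Rightarrow> 'b::real_normed_vector"
  assumes "f differentiable (at x)"
  shows "frechet_derivative f (at x) v = (\<Sum>b\<in>Basis. (v \<bullet> b) *\<^sub>R frechet_derivative f (at x) b)"
proof -
  have lin: "linear (frechet_derivative f (at x))"
    using assms linear_frechet_derivative by blast
  have "frechet_derivative f (at x) v = frechet_derivative f (at x) (\<Sum>b\<in>Basis. (v \<bullet> b) *\<^sub>R b)"
    by (simp add: euclidean_representation)
  also have "\<dots> = (\<Sum>b\<in>Basis. (v \<bullet> b) *\<^sub>R frechet_derivative f (at x) b)"
    by (simp add: linear_sum[OF lin] linear_scale[OF lin])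
  finally show ?thesis .
qed

text \<open>By induction: each further derivative is linear in its direction. The sum runs over
  ordered lists of basis vectors, so that an induction step only prepends the new direction
  \<open>c\<close> to \<open>bs\<close>.\<close>

lemma dderiv_replicate_Basis_expansion:
  fixes f :: "'a::euclidean_space \<Rightarrow> 'b::real_normed_vector"
  assumes "smooth_fun f"
  shows "dderiv (replicate k v) f x =
    (\<Sum>bs | set bs \<subseteq> Basis \<and> length bs = k. (\<Prod>b\<leftarrow>bs. v \<bullet> b) *\<^sub>R dderiv bs f x)"
proof (induction k arbitrary: x)
  case 0
  have "{bs. set bs \<subseteq> Basis \<and> length bs = 0} = {[] :: 'a list}" by auto
  then show ?case by simp
next
  case (Suc k)
  let ?L = "\<lambda>k. {bs. set bs \<subseteq> (Basis::'a set) \<and> length bs = k}"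
  have fin: "finite (?L k)" by (rule finite_lists_length_eq) simp
  have diff: "dderiv bs f differentiable (at x)" for bs
    using assms by (simp add: smooth_fun_def)
  have "((\<lambda>x. \<Sum>bs\<in>?L k. (\<Prod>b\<leftarrow>bs. v \<bullet> b) *\<^sub>R dderiv bs f x) has_derivative
      (\<lambda>h. \<Sum>bs\<in>?L k. (\<Prod>b\<leftarrow>bs. v \<bullet> b) *\<^sub>R frechet_derivative (dderiv bs f) (at x) h)) (at x)"
    by (intro has_derivative_sum has_derivative_scaleR_right frechet_derivative_works[THEN iffD1] diff)
  then have "frechet_derivative (dderiv (replicate k v) f) (at x) =
      (\<lambda>h. \<Sum>bs\<in>?L k. (\<Prod>b\<leftarrow>bs. v \<bullet> b) *\<^sub>R frechet_derivative (dderiv bs f) (at x) h)"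
    unfolding Suc.IH[abs_def] by (rule frechet_derivative_at[symmetric])
  then have "dderiv (replicate (Suc k) v) f x =
      (\<Sum>bs\<in>?L k. (\<Prod>b\<leftarrow>bs. v \<bullet> b) *\<^sub>R frechet_derivative (dderiv bs f) (at x) v)"
    by simp
  also have "\<dots> = (\<Sum>bs\<in>?L k. \<Sum>c\<in>Basis. (\<Prod>b\<leftarrow>c # bs. v \<bullet> b) *\<^sub>R dderiv (c # bs) f x)"
    by (subst frechet_derivative_Basis_expansion[OF diff])
      (simp add: scaleR_sum_right mult.commute)
  also have "\<dots> = (\<Sum>(bs, c)\<in>?L k \<times> Basis. (\<Prod>b\<leftarrow>c # bs. v \<bullet> b) *\<^sub>R dderiv (c # bs) f x)"
    by (simp add: sum.cartesian_product)
  also have "\<dots> = (\<Sum>bs\<in>?L (Suc k). (\<Prod>b\<leftarrow>bs. v \<bullet> b) *\<^sub>R dderiv bs f x)"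
    by (rule sum.reindex_bij_witness[where i="\<lambda>bs. (tl bs, hd bs)" and j="\<lambda>(bs, c). c # bs"])
      (auto simp: length_Suc_conv)
  finally show ?case .
qed

text \<open>Taylor's formula with integral remainder along the segment from \<open>w\<close> to
  \<open>w + v\<close>. The kernel \<open>(1 - \<theta>) ^ p / fact p\<close> is at most
  \<open>1\<close> there, so the bound on the derivative of order \<open>Suc p\<close> passes to the
  remainder without a factor.\<close>

lemma smooth_fun_Taylor_remainder:
  fixes f :: "'a::euclidean_space \<Rightarrow> 'b::banach"
  assumes "smooth_fun f"
    and B: "\<And>\<theta>. 0 \<le> \<theta> \<Longrightarrow> \<theta> \<le> 1 \<Longrightarrow> norm (dderiv (replicate (Suc p) v) f (w + \<theta> *\<^sub>R v)) \<le> B"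
  shows "norm (f (w + v) - (\<Sum>k\<le>p. (1 / fact k) *\<^sub>R dderiv (replicate k v) f w)) \<le> B"
proof -
  define Df where "Df k \<theta> = dderiv (replicate k v) f (w + \<theta> *\<^sub>R v)" for k \<theta>
  define i where "i \<theta> = ((1 - \<theta>) ^ (Suc p - 1) / fact (Suc p - 1)) *\<^sub>R Df (Suc p) \<theta>" for \<theta>
  have D: "(Df m has_vector_derivative Df (Suc m) t) (at t within {0..1})" for m t
  proof -
    have "(dderiv (replicate m v) f has_derivative
        frechet_derivative (dderiv (replicate m v) f) (at (w + t *\<^sub>R v))) (at (w + t *\<^sub>R v))"
      using assms(1) by (intro frechet_derivative_works[THEN iffD1]) (simp add: smooth_fun_def)
    moreover have "((\<lambda>t. w + t *\<^sub>R v) has_vector_derivative v) (at t within {0..1})"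
      by (auto intro!: derivative_eq_intros simp: has_vector_derivative_def)
    ultimately have "(dderiv (replicate m v) f \<circ> (\<lambda>t. w + t *\<^sub>R v) has_vector_derivative
        frechet_derivative (dderiv (replicate m v) f) (at (w + t *\<^sub>R v)) v) (at t within {0..1})"
      by (metis vector_derivative_diff_chain_within has_derivative_at_withinI)
    then show ?thesis by (simp add: Df_def[abs_def] o_def)
  qed
  have Df0: "Df 0 = (\<lambda>\<theta>. f (w + \<theta> *\<^sub>R v))" by (simp add: Df_def[abs_def])
  have eq: "f (w + v) = (\<Sum>k<Suc p. ((1 - 0) ^ k / fact k) *\<^sub>R Df k 0) + integral {0..1} i"
    using Taylor_integral[of "Suc p" Df, OF _ Df0 D] unfolding i_def[abs_def] by simp
  have int: "i integrable_on {0..1}"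
    using Taylor_integrable[of "Suc p" Df, OF _ Df0 D] unfolding i_def[abs_def] by simp
  have "norm (i \<theta>) \<le> B" if "\<theta> \<in> {0..1}" for \<theta>
  proof -
    have "(1 - \<theta>) ^ p \<le> 1" "0 \<le> (1 - \<theta>) ^ p" using that by (auto simp: power_le_one)
    moreover have "(1::real) \<le> fact p" by (rule fact_ge_1)
    ultimately have c: "\<bar>(1 - \<theta>) ^ p / fact p\<bar> \<le> 1"
      using order_trans[of "(1 - \<theta>) ^ p" 1 "fact p"] by (simp del: fact_ge_1 add: divide_le_eq_1)
    have "norm (i \<theta>) = \<bar>(1 - \<theta>) ^ p / fact p\<bar> * norm (Df (Suc p) \<theta>)"
      by (simp add: i_def)
    also have "\<dots> \<le> 1 * B"
      using B[of \<theta>] that c by (intro mult_mono) (auto simp: Df_def)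
    finally show ?thesis by simp
  qed
  then have "norm (integral {0..1} i) \<le> integral {0..1} (\<lambda>_::real. B)"
    by (intro integral_norm_bound_integral int) auto
  then show ?thesis
    unfolding eq by (simp add: lessThan_Suc_atMost Df_def)
qed

lemma norm_dderiv_replicate_le:
  fixes f :: "'a::euclidean_space \<Rightarrow> 'b::real_normed_vector"
  assumes "smooth_fun f"
  shows "norm (dderiv (replicate k v) f x) \<le>
    norm v ^ k * (\<Sum>bs | set bs \<subseteq> Basis \<and> length bs = k. norm (dderiv bs f x))"
proof -
  have p: "\<bar>\<Prod>b\<leftarrow>bs. v \<bullet> b\<bar> \<le> norm v ^ length bs" if "set bs \<subseteq> Basis" for bs
    using that by (induction bs) (auto simp: abs_mult Basis_le_norm intro!: mult_mono)
  show ?thesis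
    unfolding dderiv_replicate_Basis_expansion[OF assms] sum_distrib_left
    using p by (intro order_trans[OF norm_sum] sum_mono) (auto intro!: mult_right_mono)
qed

text \<open>The Schwartz seminorms concern fixed directions. Expanding \<open>v\<close> in the basis
  leaves finitely many lists, whose constants are summed; this makes the bound uniform in the
  direction of \<open>v\<close> and homogeneous of degree \<open>k\<close>.\<close>

lemma schwartz_dderiv_replicate_decay:
  fixes f :: "'a::euclidean_space \<Rightarrow> 'b::real_normed_vector"
  assumes "schwartz f"
  obtains c where "c \<ge> 0"
    and "\<And>v x. norm (dderiv (replicate k v) f x) * (1 + norm x) ^ N \<le> c * norm v ^ k"
proof -
  let ?L = "{bs. set bs \<subseteq> (Basis::'a set) \<and> length bs = k}"
  have "\<exists>c. \<forall>x. (1 + norm x) ^ N * norm (dderiv bs f x) \<le> c" for bs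
  proof -
    have "bounded (range (\<lambda>x. (1 + norm x) ^ N * norm (dderiv bs f x)))"
      using assms by (simp add: schwartz_def)
    then obtain B where "\<And>x. norm ((1 + norm x) ^ N * norm (dderiv bs f x)) \<le> B"
      unfolding bounded_iff by blast
    then show ?thesis
      by (intro exI[of _ B]) (metis abs_le_D1 real_norm_def)
  qed
  then obtain c where c: "\<And>bs x. (1 + norm x) ^ N * norm (dderiv bs f x) \<le> c bs" by metis
  have c0: "c bs \<ge> 0" for bs
    using c[of 0 bs] by (simp add: order_trans[OF norm_ge_zero])
  have "norm (dderiv (replicate k v) f x) * (1 + norm x) ^ N \<le> sum c ?L * norm v ^ k" for v x
  proof -
    have "norm (dderiv (replicate k v) f x) * (1 + norm x) ^ N \<le>
        norm v ^ k * (\<Sum>bs\<in>?L. norm (dderiv bs f x)) * (1 + norm x) ^ N"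
      using assms by (intro mult_right_mono norm_dderiv_replicate_le) (auto simp: schwartz_def)
    also have "\<dots> = norm v ^ k * (\<Sum>bs\<in>?L. (1 + norm x) ^ N * norm (dderiv bs f x))"
      by (simp add: sum_distrib_left mult_ac)
    also have "\<dots> \<le> norm v ^ k * sum c ?L"
      by (intro mult_left_mono sum_mono c) auto
    finally show ?thesis by (simp add: mult.commute)
  qed
  then show ?thesis
    using c0 by (intro that[of "sum c ?L"]) (auto intro: sum_nonneg)
qed

section \<open>Uniform and Lipschitz bounds for smooth functions of compact support\<close>

lemma dderiv_eq_0_if_support_subset:
  assumes "closed K" "\<And>x. x \<notin> K \<Longrightarrow> f x = 0" "x \<notin> K"
  shows "dderiv vs f x = 0"
  using assms(3)
proof (induction vs arbitrary: x)
  case (Cons v vs)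
  have "((\<lambda>_. 0) has_derivative (\<lambda>_. 0)) (at x)" by simp
  then have "(dderiv vs f has_derivative (\<lambda>_. 0)) (at x)"
    by (rule has_derivative_transform_within_open[where s="- K"])
      (use Cons assms(1) in auto)
  then show ?case by (simp add: frechet_derivative_at[symmetric])
qed (use assms in auto)

lemma smooth_compact_supp_bounded:
  fixes f :: "'a::real_normed_vector \<Rightarrow> 'b::real_normed_vector"
  assumes "smooth_fun f" "compact K" "\<And>x. x \<notin> K \<Longrightarrow> f x = 0"
  obtains B where "B \<ge> 0" "\<And>x. norm (dderiv vs f x) \<le> B"
proof -
  have "compact (dderiv vs f ` K)"
    using assms by (intro compact_continuous_image smooth_fun_continuous_on smooth_fun_dderiv)
  then obtain B where "\<And>x. x \<in> K \<Longrightarrow> norm (dderiv vs f x) \<le> B"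
    by (meson bounded_iff compact_imp_bounded imageI)
  then have "norm (dderiv vs f x) \<le> \<bar>B\<bar>" for x
    using dderiv_eq_0_if_support_subset[OF compact_imp_closed[OF assms(2)] assms(3), where vs=vs and x=x]
    by (cases "x \<in> K") (auto intro: order_trans[OF _ abs_ge_self])
  then show ?thesis by (intro that[of "\<bar>B\<bar>"]) auto
qed

text \<open>Mean value inequality: the operator norm of the derivative is controlled by the finitely
  many partial derivatives along \<open>Basis\<close>, each bounded by compactness of
  \<open>K\<close>.\<close>

lemma smooth_compact_supp_Lipschitz:
  fixes f :: "'a::euclidean_space \<Rightarrow> 'b::real_normed_vector"
  assumes "smooth_fun f" "compact K" "\<And>x. x \<notin> K \<Longrightarrow> f x = 0"
  obtains B where "B \<ge> 0" "\<And>x y. norm (f x - f y) \<le> B * norm (x - y)"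
proof -
  have "\<exists>B\<ge>0. \<forall>x. norm (dderiv [b] f x) \<le> B" for b
    by (rule smooth_compact_supp_bounded[OF assms, of "[b]"]) auto
  then obtain B where B: "\<And>b. B b \<ge> 0" "\<And>b x. norm (frechet_derivative f (at x) b) \<le> B b"
    by (metis dderiv.simps)
  have "norm (f x - f y) \<le> sum B Basis * norm (x - y)" for x y
  proof (rule differentiable_bound[of UNIV])
    fix x
    show "(f has_derivative frechet_derivative f (at x)) (at x within UNIV)"
      using assms by (simp add: frechet_derivative_works[THEN iffD1] smooth_fun_differentiable)
    have "norm (frechet_derivative f (at x) v) \<le> sum B Basis * norm v" for v
    proof -
      have "norm (frechet_derivative f (at x) v) \<le>
          (\<Sum>b\<in>Basis. norm ((v \<bullet> b) *\<^sub>R frechet_derivative f (at x) b))"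
        using assms frechet_derivative_Basis_expansion[of f x v]
        by (simp add: smooth_fun_differentiable sum_norm_le)
      also have "\<dots> \<le> (\<Sum>b\<in>Basis. norm v * B b)"
        using B by (intro sum_mono) (auto intro!: mult_mono simp: Basis_le_norm)
      finally show ?thesis by (simp add: sum_distrib_left mult.commute)
    qed
    then show "onorm (frechet_derivative f (at x)) \<le> sum B Basis"
      by (intro onorm_le)
  qed auto
  then show ?thesis using B by (intro that[of "sum B Basis"]) (auto intro: sum_nonneg)
qed

text \<open>The mixed difference is Lipschitz in the first variable because its partial derivatives
  are increments of the smooth functions \<open>dderiv [(b, 0)] f\<close> in the second variable.\<close>

lemma smooth_compact_supp_mixed_Lipschitz:
  fixes f :: "'a::euclidean_space \<times> 'b::euclidean_space \<Rightarrow> 'c::real_normed_vector"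
  assumes "smooth_fun f" "compact K" "\<And>x. x \<notin> K \<Longrightarrow> f x = 0"
  obtains B where "B \<ge> 0"
    "\<And>x x' y y'. norm ((f (x, y) - f (x', y)) - (f (x, y') - f (x', y'))) \<le> B * norm (x - x') * norm (y - y')"
proof -
  have van: "dderiv vs f x = 0" if "x \<notin> K" for vs x
    using dderiv_eq_0_if_support_subset[OF compact_imp_closed[OF assms(2)] assms(3) that] .
  have "\<exists>B\<ge>0. \<forall>x y. norm (dderiv [b] f x - dderiv [b] f y) \<le> B * norm (x - y)" for b
  proof -
    obtain B where "B \<ge> 0" "\<And>x y. norm (dderiv [b] f x - dderiv [b] f y) \<le> B * norm (x - y)"
      using smooth_compact_supp_Lipschitz[OF smooth_fun_dderiv[OF assms(1)] assms(2) van] by metis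
    then show ?thesis by blast
  qed
  then obtain B where B: "\<And>b. B b \<ge> 0"
      "\<And>b x y. norm (frechet_derivative f (at x) b - frechet_derivative f (at y) b) \<le> B b * norm (x - y)"
    by (metis dderiv.simps)
  let ?B = "\<Sum>b\<in>Basis. B (b, 0)"
  have "norm ((f (x, y) - f (x, y')) - (f (x', y) - f (x', y'))) \<le> (?B * norm (y - y')) * norm (x - x')"
    for x x' y y'
  proof (rule differentiable_bound[of UNIV])
    fix x
    let ?D = "\<lambda>u. frechet_derivative f (at (x, y)) (u, 0) - frechet_derivative f (at (x, y')) (u, 0)"
    have d: "((\<lambda>x. f (x, y)) has_derivative (\<lambda>u. frechet_derivative f (at (x, y)) (u, 0))) (at x)" for y
    proof -
      have "((\<lambda>x. (x, y)) has_derivative (\<lambda>u. (u, 0))) (at x)"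
        by (auto intro!: derivative_eq_intros)
      moreover have "(f has_derivative frechet_derivative f (at (x, y))) (at (x, y))"
        using assms by (simp add: frechet_derivative_works[THEN iffD1] smooth_fun_differentiable)
      ultimately show ?thesis
        using has_derivative_compose[of "\<lambda>x. (x, y)" "\<lambda>u. (u, 0)" x UNIV f] by simp
    qed
    show D: "((\<lambda>x. f (x, y) - f (x, y')) has_derivative ?D) (at x within UNIV)"
      using d by (intro has_derivative_diff) auto
    have lin: "linear ?D" using D has_derivative_linear by blast
    have "norm (?D v) \<le> (?B * norm (y - y')) * norm v" for v
    proof -
      have "?D v = (\<Sum>b\<in>Basis. (v \<bullet> b) *\<^sub>R ?D b)"
        using linear_sum[OF lin, of "\<lambda>b. (v \<bullet> b) *\<^sub>R b" Basis] linear_scale[OF lin]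
        by (simp add: euclidean_representation)
      also have "norm \<dots> \<le> (\<Sum>b\<in>Basis. norm ((v \<bullet> b) *\<^sub>R ?D b))"
        by (rule norm_sum)
      also have "\<dots> \<le> (\<Sum>b\<in>Basis. norm v * (B (b, 0) * norm (y - y')))"
        using B(1) B(2)[of "(x, y)" _ "(x, y')"]
        by (intro sum_mono) (auto intro!: mult_mono simp: Basis_le_norm norm_Pair)
      finally show ?thesis by (simp add: sum_distrib_left sum_distrib_right mult_ac)
    qed
    then show "onorm ?D \<le> ?B * norm (y - y')"
      by (intro onorm_le)
  qed auto
  then show ?thesis
    using B by (intro that[of ?B]) (auto intro: sum_nonneg simp: algebra_simps)
qed

section \<open>Convolution with a dilated Schwartz function\<close>

lemma integrable_continuous_compact_support:
  fixes f :: "'a::euclidean_space \<Rightarrow> 'b::{banach, second_countable_topology}"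
  assumes "continuous_on UNIV f" "compact K" "\<And>x. x \<notin> K \<Longrightarrow> f x = 0"
  shows "integrable lborel f"
proof -
  have "integrable lborel (\<lambda>x. indicator K x *\<^sub>R f x)"
    using assms by (intro borel_integrable_compact) (auto intro: continuous_on_subset)
  moreover have "(\<lambda>x. indicator K x *\<^sub>R f x) = f"
    using assms(3) by (auto simp: indicator_def fun_eq_iff)
  ultimately show ?thesis by simp
qed

text \<open>On the shell where \<open>norm x\<close> has integer part \<open>k\<close>, the
  integrand is at most \<open>1 / (1 + k) ^ (n + 2)\<close>. The shell is enlarged to the ball of
  radius \<open>k + 1\<close>, whose volume is a multiple of \<open>(k + 1) ^ n\<close>, which
  leaves the series of \<open>1 / (k + 1) ^ 2\<close>. With one power less the series would be
  harmonic.\<close>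

lemma integrable_inverse_power_1_plus_norm:
  "integrable lborel (\<lambda>x::'a::euclidean_space. 1 / (1 + norm x) ^ (DIM('a) + 2))"
proof (rule integrableI_bounded)
  let ?n = "DIM('a)"
  have single: "g k \<le> suminf g" for g :: "nat \<Rightarrow> ennreal" and k
    using sum_le_suminf[of g "{k}"] by simp
  have scale: "1 / a ^ (?n + 2) * (V * a ^ ?n) = V * (1 / a ^ 2)" if "a > 0" for a V :: real
    using that by (simp only: power_add) (simp add: field_simps)
  have le: "ennreal (norm (1 / (1 + norm x) ^ (?n + 2))) \<le>
      (\<Sum>k. ennreal (1 / (1 + real k) ^ (?n + 2)) * indicator (ball 0 (real k + 1)) x)" for x :: 'a
  proof -
    define k where "k = nat \<lfloor>norm x\<rfloor>"
    have k: "real k \<le> norm x" "norm x < real k + 1"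
      unfolding k_def using of_int_floor_le[of "norm x"] by (auto simp: of_nat_nat)
    have "ennreal (norm (1 / (1 + norm x) ^ (?n + 2))) \<le> ennreal (1 / (1 + real k) ^ (?n + 2))"
      using k by (intro ennreal_leI) (auto intro!: divide_left_mono power_mono simp del: power_Suc)
    also have "\<dots> = (\<lambda>k. ennreal (1 / (1 + real k) ^ (?n + 2)) * indicator (ball 0 (real k + 1)) x) k"
      using k by simp
    also have "\<dots> \<le> (\<Sum>k. ennreal (1 / (1 + real k) ^ (?n + 2)) * indicator (ball 0 (real k + 1)) x)"
      by (rule single)
    finally show ?thesis .
  qed
  have "summable (\<lambda>k. unit_ball_vol (real ?n) * (1 / (real (Suc k)) ^ 2))"
    using inverse_power_summable[of 2, where 'a=real]
    by (intro summable_mult) (subst summable_Suc_iff, simp add: inverse_eq_divide)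
  then have s: "summable (\<lambda>k. unit_ball_vol (real ?n) * (1 / (1 + real k) ^ 2))"
    by (simp add: add.commute)
  have "(\<integral>\<^sup>+x. ennreal (norm (1 / (1 + norm x) ^ (?n + 2))) \<partial>(lborel :: 'a measure)) \<le>
      (\<integral>\<^sup>+x. (\<Sum>k. ennreal (1 / (1 + real k) ^ (?n + 2)) * indicator (ball 0 (real k + 1)) x) \<partial>(lborel :: 'a measure))"
    by (rule nn_integral_mono) (rule le)
  also have "\<dots> = (\<Sum>k. ennreal (1 / (1 + real k) ^ (?n + 2)) * emeasure lborel (ball (0::'a) (real k + 1)))"
    by (subst nn_integral_suminf) (auto simp: nn_integral_cmult_indicator simp del: power_Suc
        intro!: borel_measurable_times_ennreal borel_measurable_indicator)
  also have "\<dots> = (\<Sum>k. ennreal (unit_ball_vol (real ?n) * (1 / (1 + real k) ^ 2)))"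
    by (intro suminf_cong)
      (simp only: emeasure_ball ennreal_mult[symmetric] unit_ball_vol_nonneg add.commute[of "real _" 1]
        scale, simp add: ennreal_mult[symmetric] unit_ball_vol_nonneg power2_eq_square flip: scale)
  also have "\<dots> = ennreal (\<Sum>k. unit_ball_vol (real ?n) * (1 / (1 + real k) ^ 2))"
    by (intro suminf_ennreal2 s) (simp add: unit_ball_vol_nonneg)
  finally show "(\<integral>\<^sup>+x. ennreal (norm (1 / (1 + norm x) ^ (?n + 2))) \<partial>(lborel :: 'a measure)) < \<infinity>"
    using ennreal_less_top order_le_less_trans by fastforce
qed measurable

lemma schwartz_integrable_weighted:
  fixes \<phi> :: "'a::euclidean_space \<Rightarrow> 'b::{banach, second_countable_topology}"
  assumes "schwartz \<phi>"
  shows "integrable lborel (\<lambda>x. (1 + norm x) ^ N *\<^sub>R \<phi> x)"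
proof -
  \<comment> \<open>The decay exponent exceeds \<open>N\<close> by \<open>DIM('a) + 2\<close>, which
    leaves the integrable power just established. No derivative is taken, so the direction
    \<open>v\<close> is a dummy.\<close>
  obtain c where c: "c \<ge> 0" "\<And>v x. norm (dderiv (replicate 0 v) \<phi> x) * (1 + norm x) ^ (N + (DIM('a) + 2)) \<le> c * norm v ^ 0"
    using schwartz_dderiv_replicate_decay[OF assms] by metis
  have [measurable]: "\<phi> \<in> borel_measurable borel"
    using assms by (intro borel_measurable_continuous_onI smooth_fun_continuous_on) (simp add: schwartz_def)
  show ?thesis
  proof (rule Bochner_Integration.integrable_bound)
    show "integrable lborel (\<lambda>x::'a. c * (1 / (1 + norm x) ^ (DIM('a) + 2)))"
      by (intro integrable_mult_right integrable_inverse_power_1_plus_norm)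
    have "norm ((1 + norm x) ^ N *\<^sub>R \<phi> x) \<le> c * (1 / (1 + norm x) ^ (DIM('a) + 2))" for x
    proof -
      have "0 < (1 + norm x) ^ (DIM('a) + 2)" by (intro zero_less_power) (simp add: add_pos_nonneg)
      then show ?thesis
        using c(2)[of undefined x] by (simp add: power_add field_simps)
    qed
    then show "AE x in lborel. norm ((1 + norm x) ^ N *\<^sub>R \<phi> x) \<le> norm (c * (1 / (1 + norm x) ^ (DIM('a) + 2)))"
      by (intro AE_I2) (metis abs_ge_self order_trans real_norm_def)
  qed measurable
qed

lemma lborel_integral_reflect_scale:
  fixes f :: "'a::euclidean_space \<Rightarrow> 'b::{banach, second_countable_topology}"
  assumes [measurable]: "f \<in> borel_measurable borel" and "t > 0"
  shows "integral\<^sup>L lborel f = t ^ DIM('a) *\<^sub>R (\<integral>u. f (y - t *\<^sub>R u) \<partial>lborel)"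
proof -
  have "integral\<^sup>L lborel f =
      integral\<^sup>L (density (distr lborel borel (\<lambda>x. y + (- t) *\<^sub>R x)) (\<lambda>_. ennreal (\<bar>- t\<bar> ^ DIM('a)))) f"
    using lborel_affine[of "- t" y] assms(2) by (simp add: ennreal_power)
  also have "\<dots> = (\<integral>x. (\<bar>- t\<bar> ^ DIM('a)) *\<^sub>R f x \<partial>distr lborel borel (\<lambda>x. y + (- t) *\<^sub>R x))"
    by (subst integral_density) auto
  also have "\<dots> = (\<integral>x. (\<bar>- t\<bar> ^ DIM('a)) *\<^sub>R f (y + (- t) *\<^sub>R x) \<partial>lborel)"
    by (subst integral_distr) auto
  finally show ?thesis using assms(2) by simp
qed

text \<open>The substitution \<open>z = y - t u\<close> moves the dilation from
  \<open>\<phi>\<close> to \<open>h\<close>, where for small \<open>t\<close> it becomes a small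
  displacement. Its Jacobian cancels the normalisation of \<open>dil\<close>.\<close>

lemma conv_dil_eq:
  fixes \<phi> h :: "real^'n::finite \<Rightarrow> complex"
  assumes [measurable]: "\<phi> \<in> borel_measurable borel" "h \<in> borel_measurable borel" and t: "t > 0"
  shows "conv (dil t \<phi>) h y = (\<integral>u. \<phi> u * h (y - t *\<^sub>R u) \<partial>lborel)"
proof -
  have "conv (dil t \<phi>) h y =
      t ^ DIM(real^'n) *\<^sub>R (\<integral>u. dil t \<phi> (y - (y - t *\<^sub>R u)) * h (y - t *\<^sub>R u) \<partial>lborel)"
    unfolding conv_def dil_def by (rule lborel_integral_reflect_scale) (use t in measurable)
  also have "\<dots> = t ^ CARD('n) *\<^sub>R (\<integral>u. of_real (1 / t ^ CARD('n)) * (\<phi> u * h (y - t *\<^sub>R u)) \<partial>lborel)"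
    using t by (simp add: dil_def mult.assoc)
  also have "\<dots> = (\<integral>u. \<phi> u * h (y - t *\<^sub>R u) \<partial>lborel)"
    using t unfolding integral_mult_right_zero by (simp add: scaleR_conv_of_real)
  finally show ?thesis .
qed

text \<open>One constant \<open>B\<close> serves as sup bound and as Lipschitz constant. It is a
  parameter because later it depends on the scale and position in the other variable. Asking for
  Lipschitz continuity instead of smoothness lets partial convolutions qualify through increment
  bounds alone.\<close>

definition moment_bump :: "nat \<Rightarrow> real \<Rightarrow> real \<Rightarrow> (real^'n::finite \<Rightarrow> complex) \<Rightarrow> bool" where
  "moment_bump s R B h \<longleftrightarrow>
     (\<forall>x y. norm (h x - h y) \<le> B * norm (x - y)) \<and> (\<forall>x. norm (h x) \<le> B) \<and>
     (\<forall>x. R < norm x \<longrightarrow> h x = 0) \<and>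
     (\<forall>\<alpha>. mdeg \<alpha> \<le> s \<longrightarrow> (\<integral>x. h x * of_real (monom \<alpha> x) \<partial>lborel) = 0)"

lemma moment_bumpD:
  assumes "moment_bump s R B h"
  shows "norm (h x - h y) \<le> B * norm (x - y)" "norm (h x) \<le> B" "R < norm x \<Longrightarrow> h x = 0"
    "mdeg \<alpha> \<le> s \<Longrightarrow> (\<integral>x. h x * of_real (monom \<alpha> x) \<partial>lborel) = 0"
  using assms by (auto simp: moment_bump_def)

lemma moment_bump_nonneg: "moment_bump s R B h \<Longrightarrow> 0 \<le> B"
  using moment_bumpD(2) norm_ge_zero order_trans by blast

lemma moment_bump_continuous: "moment_bump s R B h \<Longrightarrow> continuous_on S h"
  by (rule lipschitz_on_continuous_on[of B], rule lipschitz_onI)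
    (auto simp: dist_norm moment_bumpD moment_bump_nonneg)

text \<open>Since \<open>\<phi>\<close> has mean zero, \<open>h (y - t u)\<close> may be replaced by the increment
  \<open>h (y - t u) - h y\<close>, which is nonzero only if \<open>y\<close> is close to the support of \<open>h\<close> or
  \<open>norm y \<le> 2 t norm u\<close>.\<close>

lemma conv_dil_bound_small:
  fixes \<phi> :: "real^'n::finite \<Rightarrow> complex"
  assumes \<phi>: "schwartz \<phi>" "(\<integral>x. \<phi> x \<partial>lborel) = 0" and R: "R \<ge> 0"
  obtains C where "C \<ge> 0" "\<And>h B t y. moment_bump s R B h \<Longrightarrow> 0 < t \<Longrightarrow> t \<le> 1 \<Longrightarrow>
    norm (conv (dil t \<phi>) h y) \<le> C * B * (t / (1 + norm y) ^ N)"
proof -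
  \<comment> \<open>The power beyond \<open>N\<close> absorbs the factor \<open>norm u\<close> that
    the Lipschitz bound on \<open>h\<close> produces.\<close>
  define I where "I = (\<integral>u. norm ((1 + norm u) ^ (N + 1) *\<^sub>R \<phi> u) \<partial>lborel)"
  have I: "integrable lborel (\<lambda>u. norm ((1 + norm u) ^ (N + 1) *\<^sub>R \<phi> u))"
    by (intro integrable_norm schwartz_integrable_weighted \<phi>)
  have [measurable]: "\<phi> \<in> borel_measurable borel"
    using \<phi> by (intro borel_measurable_continuous_onI smooth_fun_continuous_on) (simp add: schwartz_def)
  have int\<phi>: "integrable lborel \<phi>"
    using schwartz_integrable_weighted[OF \<phi>(1), of 0] by simp
  let ?C = "(2 + 2 * R) ^ N * I"
  have "norm (conv (dil t \<phi>) h y) \<le> ?C * B * (t / (1 + norm y) ^ N)"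
    if h: "moment_bump s R B h" and t: "0 < t" "t \<le> 1" for h B t y
  proof -
    note hD = moment_bumpD[OF h]
    have B: "B \<ge> 0" using moment_bump_nonneg[OF h] .
    have [measurable]: "h \<in> borel_measurable borel"
      by (intro borel_measurable_continuous_onI moment_bump_continuous[OF h])
    have pos: "(1 + norm y) ^ N > 0" by (intro zero_less_power) (simp add: add_pos_nonneg)
    have pw: "norm (h (y - t *\<^sub>R u) - h y) * (1 + norm y) ^ N \<le>
        B * t * (2 + 2 * R) ^ N * (1 + norm u) ^ (N + 1)" for u
    proof (cases "h (y - t *\<^sub>R u) - h y = 0")
      case True
      then show ?thesis using B t R by auto
    next
      case False
      \<comment> \<open>Otherwise \<open>t * norm u \<le> norm u < norm y / 2\<close> would put
        \<open>y - t u\<close> farther than \<open>R\<close> from the origin, and both values of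
        \<open>h\<close> would vanish.\<close>
      have "norm y \<le> 2 * R \<or> norm y \<le> 2 * norm u"
      proof (rule ccontr)
        assume *: "\<not> ?thesis"
        then have "h y = 0" using hD(3)[of y] R by auto
        moreover have "norm (t *\<^sub>R u) \<le> norm u" using t by (simp add: mult_left_le_one_le)
        then have "R < norm (y - t *\<^sub>R u)" using * norm_triangle_ineq2[of y "t *\<^sub>R u"] by auto
        ultimately show False using False hD(3) by auto
      qed
      moreover have "1 + 2 * R \<le> (2 + 2 * R) * (1 + norm u)" "1 + 2 * norm u \<le> (2 + 2 * R) * (1 + norm u)"
        using R by (auto simp: algebra_simps intro: add_increasing2)
      ultimately have "1 + norm y \<le> (2 + 2 * R) * (1 + norm u)" by linarith
      then have a: "(1 + norm y) ^ N \<le> (2 + 2 * R) ^ N * (1 + norm u) ^ N"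
        using power_mono[of "1 + norm y"] by (metis add_nonneg_nonneg norm_ge_zero power_mult_distrib zero_le_one)
      have "norm (h (y - t *\<^sub>R u) - h y) \<le> B * norm (- (t *\<^sub>R u))"
        using hD(1)[of "y - t *\<^sub>R u" y] by simp
      also have "\<dots> \<le> B * t * (1 + norm u)"
        using t B by (simp add: algebra_simps)
      finally have "norm (h (y - t *\<^sub>R u) - h y) * (1 + norm y) ^ N \<le>
          (B * t * (1 + norm u)) * ((2 + 2 * R) ^ N * (1 + norm u) ^ N)"
        using B t a by (intro mult_mono) auto
      then show ?thesis by (simp add: mult_ac)
    qed
    have i1: "integrable lborel (\<lambda>u. \<phi> u * h (y - t *\<^sub>R u))"
    proof (rule Bochner_Integration.integrable_bound[of _ "\<lambda>u. of_real B * \<phi> u"])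
      show "AE u in lborel. norm (\<phi> u * h (y - t *\<^sub>R u)) \<le> norm (of_real B * \<phi> u)"
        using hD(2) B by (intro AE_I2) (simp add: norm_mult mult.commute[of B] mult_left_mono)
    qed (use int\<phi> in auto)
    have "conv (dil t \<phi>) h y = (\<integral>u. \<phi> u * h (y - t *\<^sub>R u) \<partial>lborel) - (\<integral>u. \<phi> u * h y \<partial>lborel)"
      using \<phi>(2) t by (simp add: conv_dil_eq)
    also have "\<dots> = (\<integral>u. \<phi> u * (h (y - t *\<^sub>R u) - h y) \<partial>lborel)"
      using i1 int\<phi> by (subst Bochner_Integration.integral_diff[symmetric]) (auto simp: algebra_simps)
    also have "norm \<dots> \<le> (\<integral>u. (B * t * (2 + 2 * R) ^ N / (1 + norm y) ^ N) *
        norm ((1 + norm u) ^ (N + 1) *\<^sub>R \<phi> u) \<partial>lborel)"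
    proof (rule Bochner_Integration.integral_norm_bound_integral)
      show "integrable lborel (\<lambda>u. \<phi> u * (h (y - t *\<^sub>R u) - h y))"
        using i1 int\<phi> by (auto simp: algebra_simps)
      show "integrable lborel (\<lambda>u. (B * t * (2 + 2 * R) ^ N / (1 + norm y) ^ N) *
        norm ((1 + norm u) ^ (N + 1) *\<^sub>R \<phi> u))"
        by (intro integrable_mult_right I)
      fix u
      have "norm (h (y - t *\<^sub>R u) - h y) \<le> B * t * (2 + 2 * R) ^ N * (1 + norm u) ^ (N + 1) / (1 + norm y) ^ N"
        using pw[of u] pos by (simp add: pos_le_divide_eq del: power_Suc)
      then have "norm (\<phi> u) * norm (h (y - t *\<^sub>R u) - h y) \<le>
          norm (\<phi> u) * (B * t * (2 + 2 * R) ^ N * (1 + norm u) ^ (N + 1) / (1 + norm y) ^ N)"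
        by (rule mult_left_mono) simp
      then show "norm (\<phi> u * (h (y - t *\<^sub>R u) - h y)) \<le> (B * t * (2 + 2 * R) ^ N / (1 + norm y) ^ N) *
          norm ((1 + norm u) ^ (N + 1) *\<^sub>R \<phi> u)"
        by (simp add: norm_mult mult_ac)
    qed
    also have "\<dots> = ?C * B * (t / (1 + norm y) ^ N)"
      unfolding integral_mult_right_zero I_def by (simp del: power_Suc)
    finally show ?thesis .
  qed
  moreover have "?C \<ge> 0" using R by (simp add: I_def)
  ultimately show ?thesis using that by blast
qed

section \<open>Monomials, vanishing moments and Taylor polynomials\<close>

lemma monom_fun_upd: "monom (\<alpha>(i := Suc (\<alpha> i))) z = z $ i * monom \<alpha> z"
proof -
  have "monom (\<alpha>(i := Suc (\<alpha> i))) z = (\<Prod>j\<in>UNIV. (if j = i then z $ i else 1) * (z $ j) ^ \<alpha> j)"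
    unfolding monom_def by (rule prod.cong) auto
  then show ?thesis by (simp add: monom_def prod.distrib)
qed

lemma mdeg_fun_upd: "mdeg (\<alpha>(i := Suc (\<alpha> i))) = Suc (mdeg \<alpha>)"
proof -
  have "mdeg (\<alpha>(i := Suc (\<alpha> i))) = (\<Sum>j\<in>UNIV. (if j = i then 1 else 0) + \<alpha> j)"
    unfolding mdeg_def by (rule sum.cong) auto
  then show ?thesis by (simp add: mdeg_def sum.distrib)
qed

text \<open>Every basis vector is some \<open>axis i 1\<close>, so each factor contributes one
  coordinate. This links the lists that index derivatives to the multi-indices that index
  moments.\<close>

lemma prod_list_inner_Basis_monom:
  fixes bs :: "(real^'n::finite) list"
  assumes "set bs \<subseteq> Basis"
  shows "\<exists>\<alpha>. mdeg \<alpha> = length bs \<and> (\<forall>z. monom \<alpha> z = (\<Prod>b\<leftarrow>bs. z \<bullet> b))"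
  using assms
proof (induction bs)
  case Nil
  show ?case by (rule exI[of _ "\<lambda>_. 0"]) (simp add: mdeg_def monom_def)
next
  case (Cons b bs)
  then obtain \<alpha> where "mdeg \<alpha> = length bs" "\<forall>z. monom \<alpha> z = (\<Prod>b\<leftarrow>bs. z \<bullet> b)" by auto
  moreover obtain i where "b = axis i 1" using Cons.prems by (auto simp: Basis_vec_def)
  ultimately show ?case
    using mdeg_fun_upd[of \<alpha> i] monom_fun_upd[of \<alpha> i]
    by (intro exI[of _ "\<alpha>(i := Suc (\<alpha> i))"]) (simp add: inner_axis del: fun_upd_apply)
qed

lemma prod_list_inner_scaleR:
  "(\<Prod>b\<leftarrow>bs. (c *\<^sub>R z) \<bullet> b) = c ^ length bs * (\<Prod>b\<leftarrow>bs. z \<bullet> b)"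
  by (induction bs) auto

lemma continuous_on_prod_list_inner: "continuous_on S (\<lambda>z. \<Prod>b\<leftarrow>bs. z \<bullet> b)"
  by (induction bs) (auto intro!: continuous_intros)

lemma moment_bump_integrable_mult:
  fixes h :: "real^'n::finite \<Rightarrow> complex"
  assumes "moment_bump s R B h" "continuous_on UNIV g"
  shows "integrable lborel (\<lambda>z. g z * h z)"
  using assms moment_bumpD(3)[OF assms(1)]
  by (intro integrable_continuous_compact_support[where K="cball 0 R"])
    (auto intro!: continuous_intros moment_bump_continuous[OF assms(1)])

text \<open>In the variable \<open>z\<close>, \<open>P\<close> is a polynomial of degree at most
  \<open>s\<close>, so its integral against \<open>h\<close> is a combination of vanishing moments.
  The factor \<open>c\<close> allows for the dilation, with \<open>c = - (1 / t)\<close> in the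
  application.\<close>

lemma moment_bump_orthogonal_Taylor:
  fixes \<phi> h :: "real^'n::finite \<Rightarrow> complex" and c :: real and w :: "real^'n"
  assumes "smooth_fun \<phi>" "moment_bump s R B h"
  defines "P \<equiv> \<lambda>z. \<Sum>k\<le>s. (1 / fact k) *\<^sub>R dderiv (replicate k (c *\<^sub>R z)) \<phi> w"
  shows "continuous_on UNIV P" "(\<integral>z. P z * h z \<partial>lborel) = 0"
proof -
  let ?L = "\<lambda>k. {bs. set bs \<subseteq> (Basis::(real^'n) set) \<and> length bs = k}"
  have P: "P = (\<lambda>z. \<Sum>k\<le>s. \<Sum>bs\<in>?L k.
      (of_real (c ^ k / fact k) * dderiv bs \<phi> w) * of_real (\<Prod>b\<leftarrow>bs. z \<bullet> b))"
    unfolding P_def dderiv_replicate_Basis_expansion[OF assms(1)] scaleR_sum_right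
      prod_list_inner_scaleR
    by (intro ext sum.cong refl) (auto simp: scaleR_conv_of_real)
  show "continuous_on UNIV P"
    unfolding P by (intro continuous_intros continuous_on_prod_list_inner)
  have i: "integrable lborel (\<lambda>z. of_real (\<Prod>b\<leftarrow>bs. z \<bullet> b) * h z)" for bs
    by (intro moment_bump_integrable_mult[OF assms(2)] continuous_intros continuous_on_prod_list_inner)
  have z: "(\<integral>z. of_real (\<Prod>b\<leftarrow>bs. z \<bullet> b) * h z \<partial>lborel) = 0" if bs: "bs \<in> ?L k" "k \<le> s" for bs k
  proof -
    obtain \<alpha> where "mdeg \<alpha> = length bs" "\<And>z. monom \<alpha> z = (\<Prod>b\<leftarrow>bs. z \<bullet> b)"
      using bs prod_list_inner_Basis_monom[of bs] by blast
    then show ?thesis using moment_bumpD(4)[OF assms(2), of \<alpha>] bs by (simp add: mult.commute)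
  qed
  have "(\<integral>z. P z * h z \<partial>lborel) = (\<integral>z. (\<Sum>k\<le>s. \<Sum>bs\<in>?L k.
      (of_real (c ^ k / fact k) * dderiv bs \<phi> w) * (of_real (\<Prod>b\<leftarrow>bs. z \<bullet> b) * h z)) \<partial>lborel)"
    unfolding P sum_distrib_right by (simp add: mult.assoc)
  also have "\<dots> = (\<Sum>k\<le>s. \<Sum>bs\<in>?L k. (\<integral>z.
      (of_real (c ^ k / fact k) * dderiv bs \<phi> w) * (of_real (\<Prod>b\<leftarrow>bs. z \<bullet> b) * h z) \<partial>lborel))"
    by (subst Bochner_Integration.integral_sum,
        intro Bochner_Integration.integrable_sum integrable_mult_right i,
        intro sum.cong refl Bochner_Integration.integral_sum integrable_mult_right i)
  also have "\<dots> = 0"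
    unfolding integral_mult_right_zero using z by (intro sum.neutral ballI) auto
  finally show "(\<integral>z. P z * h z \<partial>lborel) = 0" .
qed

text \<open>Subtracting the Taylor polynomial costs nothing against \<open>h\<close>. With
  \<open>N = n + s + 1\<close>, the remainder of order \<open>s + 1\<close> gives
  \<open>1 / t ^ (s + 1)\<close>, the dilation gives \<open>1 / t ^ n\<close>, and the decay of the
  derivatives near \<open>y / t\<close> gives \<open>t ^ N / (t + norm y) ^ N\<close>. All separate
  powers of \<open>t\<close> cancel.\<close>

lemma conv_dil_bound_large:
  fixes \<phi> :: "real^'n::finite \<Rightarrow> complex"
  assumes \<phi>: "schwartz \<phi>" and R: "R \<ge> 0"
  obtains C where "C \<ge> 0" "\<And>h B t y. moment_bump s R B h \<Longrightarrow> 1 \<le> t \<Longrightarrow>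
    norm (conv (dil t \<phi>) h y) \<le> C * B * (1 / (t + norm y) ^ (CARD('n) + s + 1))"
proof -
  let ?N = "CARD('n) + s + 1"
  have sm: "smooth_fun \<phi>" using \<phi> by (simp add: schwartz_def)
  obtain c where c: "c \<ge> 0" "\<And>v x. norm (dderiv (replicate (Suc s) v) \<phi> x) * (1 + norm x) ^ ?N \<le> c * norm v ^ Suc s"
    using schwartz_dderiv_replicate_decay[OF \<phi>] by metis
  define V where "V = measure lborel (cball (0::real^'n) R)"
  let ?C = "V * c * R ^ Suc s * (1 + R) ^ ?N"
  have "norm (conv (dil t \<phi>) h y) \<le> ?C * B * (1 / (t + norm y) ^ ?N)"
    if h: "moment_bump s R B h" and t: "1 \<le> t" for h B t y
  proof -
    have B: "B \<ge> 0" using moment_bump_nonneg[OF h] .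
    have t0: "t > 0" using t by simp
    \<comment> \<open>The argument \<open>(y - z) / t\<close> of \<open>\<phi>\<close> is split into
      the base point \<open>y / t\<close> and the increment \<open>- z / t\<close>.\<close>
    define w where "w = (1 / t) *\<^sub>R y"
    define P where "P z = (\<Sum>k\<le>s. (1 / fact k) *\<^sub>R dderiv (replicate k ((- (1 / t)) *\<^sub>R z)) \<phi> w)" for z
    have P: "continuous_on UNIV P" "(\<integral>z. P z * h z \<partial>lborel) = 0"
      using moment_bump_orthogonal_Taylor[OF sm h, where c="- (1 / t)" and w=w] by (simp_all add: P_def[abs_def])
    have cont: "continuous_on UNIV (\<lambda>z. \<phi> ((1 / t) *\<^sub>R (y - z)))"
      by (rule continuous_on_compose2[OF smooth_fun_continuous_on[OF sm, of UNIV]])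
        (auto intro!: continuous_intros)
    define T where "T = t ^ CARD('n)"
    have T: "T > 0" using t0 by (simp add: T_def)
    let ?K = "c * R ^ Suc s * (1 + R) ^ ?N * t ^ CARD('n) / (t + norm y) ^ ?N"
    have rem: "norm (\<phi> ((1 / t) *\<^sub>R (y - z)) - P z) \<le> ?K" if z: "norm z \<le> R" for z
    proof -
      let ?v = "(- (1 / t)) *\<^sub>R z"
      have bnd: "norm (dderiv (replicate (Suc s) ?v) \<phi> (w + \<theta> *\<^sub>R ?v)) \<le> ?K" if \<theta>: "0 \<le> \<theta>" "\<theta> \<le> 1" for \<theta>
      proof -
        define x where "x = w + \<theta> *\<^sub>R ?v"
        \<comment> \<open>Here \<open>t \<ge> 1\<close> enters: the whole segment stays within
          \<open>R\<close> of \<open>w\<close>, so \<open>1 + norm w\<close> and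
          \<open>1 + norm x\<close> are comparable.\<close>
        have "norm (\<theta> *\<^sub>R ?v) \<le> R"
        proof -
          have "\<theta> * (norm z / t) \<le> 1 * (R / 1)"
            using \<theta> z t R by (intro mult_mono frac_le) auto
          then show ?thesis using \<theta> t0 by simp
        qed
        moreover have "norm w \<le> norm x + norm (\<theta> *\<^sub>R ?v)"
          unfolding x_def by (metis add_diff_cancel norm_triangle_ineq4)
        ultimately have "norm w \<le> norm x + R" by linarith
        then have "1 + norm w \<le> (1 + R) * (1 + norm x)"
          using mult_nonneg_nonneg[OF R norm_ge_zero[of x]] by (simp add: algebra_simps)
        moreover have "t + norm y = t * (1 + norm w)"
          using t0 by (simp add: w_def field_simps)
        ultimately have "t + norm y \<le> t * ((1 + R) * (1 + norm x))"
          using t0 by simp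
        then have p: "(t + norm y) ^ ?N \<le> t ^ ?N * (1 + R) ^ ?N * (1 + norm x) ^ ?N"
          using t0 power_mono[of "t + norm y" _ ?N] by (metis add_nonneg_nonneg less_imp_le mult.assoc norm_ge_zero power_mult_distrib)
        have pos: "(1 + norm x) ^ ?N > 0" "(t + norm y) ^ ?N > 0"
          using t0 by (auto intro!: zero_less_power add_pos_nonneg simp del: power_Suc)
        have "norm (dderiv (replicate (Suc s) ?v) \<phi> x) * (t + norm y) ^ ?N \<le>
            norm (dderiv (replicate (Suc s) ?v) \<phi> x) * (t ^ ?N * (1 + R) ^ ?N * (1 + norm x) ^ ?N)"
          by (intro mult_left_mono p) simp
        also have "\<dots> = t ^ ?N * (1 + R) ^ ?N * (norm (dderiv (replicate (Suc s) ?v) \<phi> x) * (1 + norm x) ^ ?N)"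
          by (simp only: mult_ac)
        also have "\<dots> \<le> t ^ ?N * (1 + R) ^ ?N * (c * norm ?v ^ Suc s)"
          using R t0 by (intro mult_left_mono c) auto
        also have "\<dots> \<le> t ^ ?N * (1 + R) ^ ?N * (c * (R / t) ^ Suc s)"
          using R t0 z c(1) by (intro mult_left_mono power_mono) (auto intro!: divide_right_mono simp del: power_Suc)
        \<comment> \<open>The exponent \<open>?N\<close> is \<open>CARD('n) + Suc s\<close>, so the
          Taylor gain leaves exactly \<open>t ^ CARD('n)\<close>, to be cancelled by the
          normalisation \<open>1 / T\<close> of the dilation.\<close>
        also have "\<dots> = c * R ^ Suc s * (1 + R) ^ ?N * t ^ CARD('n)"
        proof -
          have "t ^ ?N = t ^ CARD('n) * t ^ Suc s" by (simp add: power_add)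
          then show ?thesis using t0 by (simp add: power_divide del: power_Suc)
        qed
        finally show ?thesis
          unfolding x_def[symmetric] using pos by (simp only: pos_le_divide_eq)
      qed
      have "w + ?v = (1 / t) *\<^sub>R (y - z)" by (simp add: w_def algebra_simps)
      then show ?thesis
        using smooth_fun_Taylor_remainder[OF sm bnd] by (simp add: P_def del: replicate_Suc)
    qed
    define K where "K = ?K"
    have K0: "K \<ge> 0" using R t0 c(1) by (simp add: K_def del: power_Suc)
    have i1: "integrable lborel (\<lambda>z. \<phi> ((1 / t) *\<^sub>R (y - z)) * h z)" and i2: "integrable lborel (\<lambda>z. P z * h z)"
      by (intro moment_bump_integrable_mult[OF h] cont P)+
    have "conv (dil t \<phi>) h y = of_real (1 / T) * (\<integral>z. \<phi> ((1 / t) *\<^sub>R (y - z)) * h z \<partial>lborel)"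
      unfolding conv_def dil_def T_def by (simp only: mult.assoc integral_mult_right_zero)
    also have "(\<integral>z. \<phi> ((1 / t) *\<^sub>R (y - z)) * h z \<partial>lborel) =
        (\<integral>z. (\<phi> ((1 / t) *\<^sub>R (y - z)) - P z) * h z \<partial>lborel)"
      using Bochner_Integration.integral_diff[OF i1 i2] P(2) by (simp add: algebra_simps)
    finally have eq: "norm (conv (dil t \<phi>) h y) =
        1 / T * norm (\<integral>z. (\<phi> ((1 / t) *\<^sub>R (y - z)) - P z) * h z \<partial>lborel)"
      using T by (simp add: norm_mult norm_divide)
    have fin: "emeasure lborel (cball (0::real^'n) R) < \<infinity>"
      using emeasure_bounded_finite[of "cball (0::real^'n) R"] by simp
    have "norm (\<integral>z. (\<phi> ((1 / t) *\<^sub>R (y - z)) - P z) * h z \<partial>lborel) \<le>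
        (\<integral>z. (K * B) * indicator (cball (0::real^'n) R) z \<partial>lborel)"
    proof (rule Bochner_Integration.integral_norm_bound_integral)
      show "integrable lborel (\<lambda>z. (\<phi> ((1 / t) *\<^sub>R (y - z)) - P z) * h z)"
        using i1 i2 by (simp add: left_diff_distrib)
      show "integrable lborel (\<lambda>z. (K * B) * indicator (cball (0::real^'n) R) z)"
        using fin by (intro integrable_mult_right integrable_real_indicator) auto
      show "norm ((\<phi> ((1 / t) *\<^sub>R (y - z)) - P z) * h z) \<le> (K * B) * indicator (cball 0 R) z" for z
        using rem[of z, folded K_def] moment_bumpD(2,3)[OF h, of z] K0
        by (cases "norm z \<le> R") (auto simp: norm_mult intro!: mult_mono)
    qed
    also have "\<dots> = (K * B) * V"
      using fin by (simp add: V_def)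
    finally have "norm (conv (dil t \<phi>) h y) \<le> 1 / T * (K * B * V)"
      unfolding eq using T by (intro mult_left_mono) auto
    also have "\<dots> = ?C * B * (1 / (t + norm y) ^ ?N)"
      using T unfolding K_def T_def[symmetric] by (simp add: field_simps del: power_Suc)
    finally show ?thesis .
  qed
  moreover have "?C \<ge> 0" using R c(1) by (simp add: V_def)
  ultimately show ?thesis using that by blast
qed

text \<open>The minimum and maximum merge the two regimes: \<open>t / (1 + norm y) ^ N\<close> for
  \<open>t \<le> 1\<close> and \<open>1 / (t + norm y) ^ N\<close> for
  \<open>t \<ge> 1\<close>.\<close>

definition decay_kernel :: "nat \<Rightarrow> real \<Rightarrow> 'a::real_normed_vector \<Rightarrow> real" where
  "decay_kernel N t y = min t 1 / (max 1 t + norm y) ^ N"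

lemma decay_kernel_nonneg: "t > 0 \<Longrightarrow> decay_kernel N t y \<ge> 0"
  by (simp add: decay_kernel_def)

text \<open>The exponent is dictated by the range \<open>t \<ge> 1\<close>, where it reflects the
  number of vanishing moments. For \<open>t \<le> 1\<close> any power is available, and the same one
  is chosen.\<close>

lemma conv_dil_bound:
  fixes \<phi> :: "real^'n::finite \<Rightarrow> complex"
  assumes \<phi>: "schwartz \<phi>" "(\<integral>x. \<phi> x \<partial>lborel) = 0" and R: "R \<ge> 0"
  obtains C where "C \<ge> 0" "\<And>h B t y. moment_bump s R B h \<Longrightarrow> 0 < t \<Longrightarrow>
    norm (conv (dil t \<phi>) h y) \<le> C * B * decay_kernel (CARD('n) + s + 1) t y"
proof -
  let ?N = "CARD('n) + s + 1"
  obtain C1 where C1: "C1 \<ge> 0" "\<And>h B t y. moment_bump s R B h \<Longrightarrow> 0 < t \<Longrightarrow> t \<le> 1 \<Longrightarrow>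
      norm (conv (dil t \<phi>) h y) \<le> C1 * B * (t / (1 + norm y) ^ ?N)"
    using conv_dil_bound_small[OF assms] by metis
  obtain C2 where C2: "C2 \<ge> 0" "\<And>h B t y. moment_bump s R B h \<Longrightarrow> 1 \<le> t \<Longrightarrow>
      norm (conv (dil t \<phi>) h y) \<le> C2 * B * (1 / (t + norm y) ^ ?N)"
    using conv_dil_bound_large[OF \<phi>(1) R] by metis
  have "norm (conv (dil t \<phi>) h y) \<le> (C1 + C2) * B * decay_kernel ?N t y"
    if h: "moment_bump s R B h" and t: "0 < t" for h B t y
  proof -
    have B: "B \<ge> 0" using moment_bump_nonneg[OF h] .
    have k: "decay_kernel ?N t y \<ge> 0" using t by (rule decay_kernel_nonneg)
    have "norm (conv (dil t \<phi>) h y) \<le> C1 * B * decay_kernel ?N t y \<or>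
        norm (conv (dil t \<phi>) h y) \<le> C2 * B * decay_kernel ?N t y"
      using C1(2)[OF h t, of y] C2(2)[OF h, of t y]
      by (cases "t \<le> 1") (auto simp: decay_kernel_def min_def max_def)
    moreover have "C1 * B * decay_kernel ?N t y \<le> (C1 + C2) * B * decay_kernel ?N t y"
        "C2 * B * decay_kernel ?N t y \<le> (C1 + C2) * B * decay_kernel ?N t y"
      using C1(1) C2(1) B k by (auto intro!: mult_right_mono)
    ultimately show ?thesis by linarith
  qed
  then show ?thesis using that[of "C1 + C2"] C1(1) C2(1) by simp
qed

section \<open>Iterated convolution on the product space and integration over the scales\<close>

lemma continuous_on_dil_reflect:
  assumes "continuous_on UNIV \<phi>"
  shows "continuous_on S (\<lambda>z. dil t \<phi> (y - z))"
  unfolding dil_def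
  by (intro continuous_intros continuous_on_compose2[OF assms]) auto

text \<open>Supplies the integrability for Fubini: \<open>f\<close> provides the compact support, so
  \<open>a\<close> and \<open>b\<close> may be monomials or reflected dilates.\<close>

lemma integrable_prod_mult_compact_support:
  fixes f :: "'a::euclidean_space \<times> 'b::euclidean_space \<Rightarrow> complex"
  assumes "continuous_on UNIV a" "continuous_on UNIV b" "continuous_on UNIV f"
    and "compact K" "\<And>x. x \<notin> K \<Longrightarrow> f x = 0"
  shows "integrable (lborel \<Otimes>\<^sub>M lborel) (\<lambda>(x, y). a x * b y * f (x, y))"
  unfolding lborel_prod
proof (rule integrable_continuous_compact_support[where K=K])
  have "continuous_on UNIV (\<lambda>x::'a \<times> 'b. a (fst x))" "continuous_on UNIV (\<lambda>x::'a \<times> 'b. b (snd x))"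
    using continuous_on_compose2[OF assms(1), of UNIV fst] continuous_on_compose2[OF assms(2), of UNIV snd]
    by (simp_all add: continuous_on_fst continuous_on_snd continuous_on_id)
  then show "continuous_on UNIV (\<lambda>(x, y). a x * b y * f (x, y))"
    unfolding case_prod_unfold using assms(3) by (simp add: continuous_on_mult)
qed (use assms in auto)

lemma eq_0_if_notin_closure_support: "x \<notin> closure {x. f x \<noteq> 0} \<Longrightarrow> f x = 0"
  using closure_subset[of "{x. f x \<noteq> 0}"] by blast

lemma continuous_on_monom: "continuous_on S (monom \<alpha>)"
  unfolding monom_def by (intro continuous_intros)

text \<open>The slices of \<open>f\<close> and their increments in \<open>z\<close> are bumps in the
  second variable, with constants \<open>B\<close> and \<open>B * norm (z1 - z1')\<close>. As the
  one-variable bound is linear in the constant, they give the sup and Lipschitz bounds in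
  \<open>z\<close>. The moments in the first variable survive by Fubini.\<close>

lemma Dspace2_conv_slice_bump:
  fixes f :: "(real^'n1::finite) \<times> (real^'n2::finite) \<Rightarrow> complex"
  assumes f: "f \<in> Dspace2 s1 s2" and \<phi>: "schwartz \<phi>" "(\<integral>x. \<phi> x \<partial>lborel) = 0"
  obtains R B where "R \<ge> 0" "B \<ge> 0" "\<And>t y. t > 0 \<Longrightarrow>
    moment_bump s1 R (B * decay_kernel (CARD('n2) + s2 + 1) t y) (\<lambda>z. conv (dil t \<phi>) (\<lambda>z2. f (z, z2)) y)"
proof -
  let ?N = "CARD('n2) + s2 + 1"
  define K where "K = closure {x. f x \<noteq> 0}"
  have sm: "smooth_fun f" using f by (simp add: Dspace2_def)
  have K: "compact K" using f by (simp add: Dspace2_def compact_supp_def K_def)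
  have mom1: "(\<integral>x1. f (x1, x2) * of_real (monom \<alpha> x1) \<partial>lborel) = 0" if "mdeg \<alpha> \<le> s1" for x2 \<alpha>
    using f that by (simp add: Dspace2_def)
  have mom2: "(\<integral>x2. f (x1, x2) * of_real (monom \<alpha> x2) \<partial>lborel) = 0" if "mdeg \<alpha> \<le> s2" for x1 \<alpha>
    using f that by (simp add: Dspace2_def)
  have van: "f x = 0" if "x \<notin> K" for x
    using that unfolding K_def by (rule eq_0_if_notin_closure_support)
  have cf: "continuous_on S f" for S using sm by (rule smooth_fun_continuous_on)
  obtain R where R: "R \<ge> 0" "\<And>x. x \<in> K \<Longrightarrow> norm x \<le> R"
    using compact_imp_bounded[OF K] unfolding bounded_pos by (metis less_imp_le)
  have van1: "f (x1, x2) = 0" if "R < norm x1" for x1 x2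
    using van[of "(x1, x2)"] R(2)[of "(x1, x2)"] norm_fst_le[of x1 x2] that by fastforce
  have van2: "f (x1, x2) = 0" if "R < norm x2" for x1 x2
    using van[of "(x1, x2)"] R(2)[of "(x1, x2)"] norm_snd_le[of x2 x1] that by fastforce
  obtain B0 where B0: "B0 \<ge> 0" "\<And>x. norm (dderiv [] f x) \<le> B0"
    using smooth_compact_supp_bounded[OF sm K van] by metis
  obtain B1 where B1: "B1 \<ge> 0" "\<And>x y. norm (f x - f y) \<le> B1 * norm (x - y)"
    using smooth_compact_supp_Lipschitz[OF sm K van] by metis
  obtain B2 where B2: "B2 \<ge> 0" "\<And>x x' y y'.
      norm ((f (x, y) - f (x', y)) - (f (x, y') - f (x', y'))) \<le> B2 * norm (x - x') * norm (y - y')"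
    using smooth_compact_supp_mixed_Lipschitz[OF sm K van] by metis
  \<comment> \<open>\<open>B0\<close> bounds the slices, \<open>B1\<close> both their Lipschitz
    constants and the size of their increments, \<open>B2\<close> the Lipschitz constants of the
    increments.\<close>
  define B where "B = B0 + B1 + B2"
  have le_B: "B0 * r \<le> B * r" "B1 * r \<le> B * r" "B2 * r \<le> B * r" if "r \<ge> 0" for r
    using B0(1) B1(1) B2(1) that by (auto simp: B_def intro!: mult_right_mono)
  have slice: "moment_bump s2 R B (\<lambda>z2. f (z1, z2))" for z1
    unfolding moment_bump_def
  proof (intro conjI allI impI)
    show "norm (f (z1, x) - f (z1, y)) \<le> B * norm (x - y)" for x y
      using B1(2)[of "(z1, x)" "(z1, y)"] le_B(2)[of "norm (x - y)"] by (simp add: norm_Pair)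
    show "norm (f (z1, x)) \<le> B" for x
      using B0(2)[of "(z1, x)"] le_B(1)[of 1] by simp
  qed (auto simp: van2 mom2)
  have int2: "integrable lborel (\<lambda>z2. b z2 * f (z1, z2))" if "continuous_on UNIV b" for z1 b
    using moment_bump_integrable_mult[OF slice that] .
  have int2': "integrable lborel (\<lambda>z2. f (z1, z2) * of_real (monom \<alpha> z2))" for z1 \<alpha>
    using int2[of "\<lambda>z2. of_real (monom \<alpha> z2)" z1]
    by (simp add: mult.commute continuous_on_of_real continuous_on_monom)
  have slice_diff: "moment_bump s2 R (B * norm (z1 - z1')) (\<lambda>z2. f (z1, z2) - f (z1', z2))" for z1 z1'
    unfolding moment_bump_def
  proof (intro conjI allI impI)
    show "norm ((f (z1, x) - f (z1', x)) - (f (z1, y) - f (z1', y))) \<le> B * norm (z1 - z1') * norm (x - y)" for x y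
      using B2(2)[of z1 x z1' y] le_B(3)[of "norm (z1 - z1') * norm (x - y)"] by (simp add: mult.assoc)
    show "norm (f (z1, x) - f (z1', x)) \<le> B * norm (z1 - z1')" for x
      using B1(2)[of "(z1, x)" "(z1', x)"] le_B(2)[of "norm (z1 - z1')"] by (simp add: norm_Pair)
    show "(\<integral>x. (f (z1, x) - f (z1', x)) * of_real (monom \<alpha> x) \<partial>lborel) = 0" if "mdeg \<alpha> \<le> s2" for \<alpha>
      using that by (simp add: left_diff_distrib Bochner_Integration.integral_diff[OF int2' int2'] mom2)
  qed (auto simp: van2)
  obtain C where C: "C \<ge> 0" "\<And>h B t y. moment_bump s2 R B h \<Longrightarrow> 0 < t \<Longrightarrow>
      norm (conv (dil t \<phi>) h y) \<le> C * B * decay_kernel ?N t y"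
    using conv_dil_bound[OF \<phi> R(1)] by metis
  have "moment_bump s1 R (C * B * decay_kernel ?N t y) (\<lambda>z. conv (dil t \<phi>) (\<lambda>z2. f (z, z2)) y)" if t: "t > 0" for t y
  proof -
    have c\<phi>: "continuous_on UNIV (\<lambda>z. dil t \<phi> (y - z))"
      using \<phi>(1) by (intro continuous_on_dil_reflect smooth_fun_continuous_on) (simp add: schwartz_def)
    have diff: "conv (dil t \<phi>) (\<lambda>z2. f (z, z2)) y - conv (dil t \<phi>) (\<lambda>z2. f (z', z2)) y =
        conv (dil t \<phi>) (\<lambda>z2. f (z, z2) - f (z', z2)) y" for z z'
      unfolding conv_def
      by (simp add: right_diff_distrib Bochner_Integration.integral_diff[OF int2 int2] c\<phi>)
    show ?thesis
      unfolding moment_bump_def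
    proof (intro conjI allI impI)
      show "norm (conv (dil t \<phi>) (\<lambda>z2. f (x, z2)) y - conv (dil t \<phi>) (\<lambda>z2. f (x', z2)) y) \<le>
          C * B * decay_kernel ?N t y * norm (x - x')" for x x'
        unfolding diff using C(2)[OF slice_diff t, of x x' y] by (simp add: mult_ac)
      show "norm (conv (dil t \<phi>) (\<lambda>z2. f (x, z2)) y) \<le> C * B * decay_kernel ?N t y" for x
        using C(2)[OF slice t] .
      show "conv (dil t \<phi>) (\<lambda>z2. f (x, z2)) y = 0" if "R < norm x" for x
        using that by (simp add: conv_def van1)
      fix \<alpha> :: "'n1 \<Rightarrow> nat" assume \<alpha>: "mdeg \<alpha> \<le> s1"
      have "(\<integral>x. conv (dil t \<phi>) (\<lambda>z2. f (x, z2)) y * of_real (monom \<alpha> x) \<partial>lborel) =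
          (\<integral>x. (\<integral>z. of_real (monom \<alpha> x) * dil t \<phi> (y - z) * f (x, z) \<partial>lborel) \<partial>lborel)"
        unfolding conv_def by (simp add: mult_ac flip: integral_mult_left_zero integral_mult_right_zero)
      also have "\<dots> = (\<integral>z. (\<integral>x. of_real (monom \<alpha> x) * dil t \<phi> (y - z) * f (x, z) \<partial>lborel) \<partial>lborel)"
        using integrable_prod_mult_compact_support[OF _ c\<phi> cf K van, of "\<lambda>x. of_real (monom \<alpha> x)"]
        by (intro lborel_pair.Fubini_integral[symmetric]) (simp add: continuous_on_of_real continuous_on_monom)
      also have "\<dots> = (\<integral>z. dil t \<phi> (y - z) * (\<integral>x. f (x, z) * of_real (monom \<alpha> x) \<partial>lborel) \<partial>lborel)"
        by (simp add: mult_ac flip: integral_mult_right_zero)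
      finally show "(\<integral>x. conv (dil t \<phi>) (\<lambda>z2. f (x, z2)) y * of_real (monom \<alpha> x) \<partial>lborel) = 0"
        by (simp add: mom1[OF \<alpha>])
    qed
  qed
  moreover have "C * B \<ge> 0" using C(1) B0(1) B1(1) B2(1) by (simp add: B_def)
  ultimately show ?thesis using that R(1) by blast
qed

text \<open>By Fubini the convolution is iterated. The inner one is a bump in the first variable
  whose constant already carries the kernel of the second, and the one-variable bound is applied to
  it once more.\<close>

lemma conv_dil2_bound:
  fixes f :: "(real^'n1::finite) \<times> (real^'n2::finite) \<Rightarrow> complex"
  assumes f: "f \<in> Dspace2 s1 s2"
    and \<phi>1: "schwartz \<phi>1" "(\<integral>x. \<phi>1 x \<partial>lborel) = 0"
    and \<phi>2: "schwartz \<phi>2" "(\<integral>x. \<phi>2 x \<partial>lborel) = 0"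
  obtains C where "C \<ge> 0" "\<And>t1 t2 y. t1 > 0 \<Longrightarrow> t2 > 0 \<Longrightarrow>
    norm (conv (dil2 t1 t2 \<phi>1 \<phi>2) f y) \<le>
      C * decay_kernel (CARD('n1) + s1 + 1) t1 (fst y) * decay_kernel (CARD('n2) + s2 + 1) t2 (snd y)"
proof -
  let ?k1 = "decay_kernel (CARD('n1) + s1 + 1)" and ?k2 = "decay_kernel (CARD('n2) + s2 + 1)"
  obtain R B where R: "R \<ge> 0" and B: "B \<ge> 0" and bump: "\<And>t y. t > 0 \<Longrightarrow>
      moment_bump s1 R (B * ?k2 t y) (\<lambda>z. conv (dil t \<phi>2) (\<lambda>z2. f (z, z2)) y)"
    using Dspace2_conv_slice_bump[OF f \<phi>2] by metis
  obtain C where C: "C \<ge> 0" "\<And>h B t y. moment_bump s1 R B h \<Longrightarrow> 0 < t \<Longrightarrow>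
      norm (conv (dil t \<phi>1) h y) \<le> C * B * ?k1 t y"
    using conv_dil_bound[OF \<phi>1 R] by metis
  have "norm (conv (dil2 t1 t2 \<phi>1 \<phi>2) f y) \<le> (C * B) * ?k1 t1 (fst y) * ?k2 t2 (snd y)"
    if t: "t1 > 0" "t2 > 0" for t1 t2 y
  proof -
    let ?K = "closure {x. f x \<noteq> 0}"
    have cf: "continuous_on UNIV f" and K: "compact ?K"
      using f by (auto simp: Dspace2_def compact_supp_def intro: smooth_fun_continuous_on)
    have van: "f x = 0" if "x \<notin> ?K" for x
      using that by (rule eq_0_if_notin_closure_support)
    have c1: "continuous_on UNIV (\<lambda>z. dil t1 \<phi>1 (fst y - z))"
      and c2: "continuous_on UNIV (\<lambda>z. dil t2 \<phi>2 (snd y - z))"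
      using \<phi>1(1) \<phi>2(1)
      by (simp_all add: continuous_on_dil_reflect smooth_fun_continuous_on schwartz_def)
    have "conv (dil2 t1 t2 \<phi>1 \<phi>2) f y =
        (\<integral>z. (\<lambda>(z1, z2). dil t1 \<phi>1 (fst y - z1) * dil t2 \<phi>2 (snd y - z2) * f (z1, z2)) z \<partial>(lborel \<Otimes>\<^sub>M lborel))"
      unfolding conv_def dil2_def lborel_prod by (simp add: case_prod_unfold)
    also have "\<dots> = (\<integral>z1. (\<integral>z2. dil t1 \<phi>1 (fst y - z1) * dil t2 \<phi>2 (snd y - z2) * f (z1, z2) \<partial>lborel) \<partial>lborel)"
      using lborel_pair.integral_fst'[OF integrable_prod_mult_compact_support[OF c1 c2 cf K van]] by simp
    also have "\<dots> = conv (dil t1 \<phi>1) (\<lambda>z1. conv (dil t2 \<phi>2) (\<lambda>z2. f (z1, z2)) (snd y)) (fst y)"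
      unfolding conv_def by (simp add: mult.assoc)
    also have "norm \<dots> \<le> C * (B * ?k2 t2 (snd y)) * ?k1 t1 (fst y)"
      using C(2)[OF bump[OF t(2)] t(1)] .
    finally show ?thesis by (simp add: mult_ac)
  qed
  then show ?thesis using that[of "C * B"] B C(1) by simp
qed

section \<open>Trading decay for spatial weight, and integration over the scales\<close>

definition scale_weight :: "real \<Rightarrow> nat \<Rightarrow> real \<Rightarrow> real" where
  "scale_weight \<tau> N t = min t 1 * max 1 t powr (\<tau> - real N)"

lemma scale_weight_nonneg: "t > 0 \<Longrightarrow> scale_weight \<tau> N t \<ge> 0"
  by (simp add: scale_weight_def)

lemma measurable_scale_weight [measurable]: "scale_weight \<tau> N \<in> borel_measurable borel"
  unfolding scale_weight_def[abs_def] by measurable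

text \<open>With \<open>m = max 1 t\<close>, the distance bound gives
  \<open>m + norm x \<le> 2 * (m + norm y)\<close>. The power \<open>\<tau>\<close> of
  \<open>m + norm x\<close> is split into the power \<open>N\<close>, absorbed by the kernel, and
  the nonpositive power \<open>\<tau> - N\<close>, bounded by that of \<open>m\<close>.\<close>

lemma decay_kernel_le_scale_weight:
  fixes x y :: "'a::real_normed_vector"
  assumes t: "t > 0" and xy: "norm (x - y) < t" and \<tau>: "0 \<le> \<tau>" "\<tau> \<le> real N"
  shows "decay_kernel N t y \<le> 2 ^ N * scale_weight \<tau> N t / (1 + norm x) powr \<tau>"
proof -
  define m where "m = max 1 t"
  have m: "m \<ge> 1" "m \<ge> t" by (auto simp: m_def)
  have "norm x \<le> norm (x - y) + norm y" using norm_triangle_ineq[of "x - y" y] by simp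
  then have "m + norm x \<le> 2 * (m + norm y)" using xy m by (smt (verit) norm_ge_zero)
  then have p: "(m + norm x) ^ N \<le> 2 ^ N * (m + norm y) ^ N"
    using m power_mono[of "m + norm x" "2 * (m + norm y)" N]
    unfolding power_mult_distrib by (simp add: add_nonneg_nonneg)
  have pos: "m + norm x > 0" "m + norm y > 0" "1 + norm x > 0" using m by (auto intro: add_pos_nonneg)
  have "(1 + norm x) powr \<tau> \<le> (m + norm x) powr \<tau>"
    using m \<tau> by (intro powr_mono2) auto
  also have "\<dots> = (m + norm x) powr (\<tau> - real N) * (m + norm x) ^ N"
    using pos by (simp add: powr_diff powr_realpow)
  also have "\<dots> \<le> m powr (\<tau> - real N) * (2 ^ N * (m + norm y) ^ N)"
    using m \<tau> p by (intro mult_mono powr_mono2') auto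
  finally have "(1 + norm x) powr \<tau> / (m + norm y) ^ N \<le> 2 ^ N * m powr (\<tau> - real N)"
    using pos by (simp add: pos_divide_le_eq mult_ac)
  then have "min t 1 * ((1 + norm x) powr \<tau> / (m + norm y) ^ N) \<le> min t 1 * (2 ^ N * m powr (\<tau> - real N))"
    using t by (intro mult_left_mono) auto
  then show ?thesis
    using pos by (simp add: decay_kernel_def scale_weight_def m_def pos_le_divide_eq mult_ac)
qed

definition scale_integral :: "real \<Rightarrow> nat \<Rightarrow> real set \<Rightarrow> ennreal" where
  "scale_integral \<tau> N A = (\<integral>\<^sup>+ t\<in>A. ennreal (scale_weight \<tau> N t / t) \<partial>lborel)"

lemma scale_integral_mono: "A \<subseteq> B \<Longrightarrow> scale_integral \<tau> N A \<le> scale_integral \<tau> N B"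
  unfolding scale_integral_def by (intro nn_integral_mono) (auto simp: indicator_def)

text \<open>Below scale \<open>1\<close> the factor \<open>min t 1 = t\<close> cancels
  \<open>1 / t\<close>, and the integrand is \<open>1\<close>.\<close>

lemma scale_integral_small:
  assumes "0 < \<epsilon>" "\<epsilon> \<le> 1"
  shows "scale_integral \<tau> N {0<..<\<epsilon>} \<le> ennreal \<epsilon>"
proof -
  have "scale_integral \<tau> N {0<..<\<epsilon>} \<le> (\<integral>\<^sup>+ t. indicator {0<..<\<epsilon>} t \<partial>lborel)"
    unfolding scale_integral_def using assms
    by (intro nn_integral_mono) (auto simp: indicator_def scale_weight_def)
  also have "\<dots> = ennreal \<epsilon>" using assms by simp
  finally show ?thesis .
qed

text \<open>From scale \<open>1\<close> on the integrand is the pure power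
  \<open>t powr (\<tau> - N - 1)\<close>, whose antiderivative tends to \<open>0\<close> because
  \<open>\<tau> < N\<close>.\<close>

lemma scale_integral_large:
  assumes "\<tau> < real N" "1 \<le> L"
  shows "scale_integral \<tau> N {L..} \<le> ennreal (L powr (\<tau> - real N) / (real N - \<tau>))"
proof -
  let ?a = "\<tau> - real N"
  have "scale_integral \<tau> N {L..} = (\<integral>\<^sup>+ t. ennreal (t powr (?a - 1)) * indicator {L..} t \<partial>lborel)"
    unfolding scale_integral_def using assms(2)
    by (intro nn_integral_cong) (auto simp: indicator_def scale_weight_def powr_diff)
  also have "\<dots> = ennreal (0 - L powr ?a / ?a)"
  proof (rule nn_integral_FTC_atLeast)
    show "DERIV (\<lambda>t. t powr ?a / ?a) t :> t powr (?a - 1)" if "L \<le> t" for t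
      using that assms by (auto intro!: derivative_eq_intros)
    have "((\<lambda>t. t powr ?a / ?a) \<longlongrightarrow> 0 / ?a) at_top"
      using assms by (intro tendsto_divide tendsto_neg_powr tendsto_const filterlim_ident) auto
    then show "((\<lambda>t. t powr ?a / ?a) \<longlongrightarrow> 0) at_top" by simp
  qed auto
  also have "0 - L powr ?a / ?a = L powr ?a / (real N - \<tau>)"
    using assms by (simp add: field_simps)
  finally show ?thesis by simp
qed

lemma scale_integral_all:
  assumes "\<tau> < real N"
  shows "scale_integral \<tau> N {0<..} \<le> ennreal (1 + 1 / (real N - \<tau>))"
proof -
  have "scale_integral \<tau> N {0<..} \<le> (\<integral>\<^sup>+ t. ennreal (scale_weight \<tau> N t / t) * indicator {0<..<1} t +
      ennreal (scale_weight \<tau> N t / t) * indicator {1..} t \<partial>lborel)"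
    unfolding scale_integral_def by (intro nn_integral_mono) (auto simp: indicator_def)
  also have "\<dots> = scale_integral \<tau> N {0<..<1} + scale_integral \<tau> N {1..}"
    unfolding scale_integral_def by (rule nn_integral_add) auto
  also have "\<dots> \<le> ennreal 1 + ennreal (1 powr (\<tau> - real N) / (real N - \<tau>))"
    using assms by (intro add_mono scale_integral_small scale_integral_large) auto
  also have "\<dots> = ennreal (1 + 1 / (real N - \<tau>))"
    using assms by (subst ennreal_plus) auto
  finally show ?thesis .
qed

section \<open>Support and size of dilates, and the weighted bound for \<open>Qint\<close>\<close>

lemma dil_eq_0:
  assumes "closure {x. \<psi> x \<noteq> 0} \<subseteq> ball 0 1" "t > 0" "t \<le> norm u"
  shows "dil t \<psi> u = 0"
proof -
  have "(1 / t) *\<^sub>R u \<notin> ball 0 1" using assms by simp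
  then have "\<psi> ((1 / t) *\<^sub>R u) = 0"
    using assms(1) by (intro eq_0_if_notin_closure_support) blast
  then show ?thesis by (simp add: dil_def)
qed

lemma norm_dil_le:
  fixes \<psi> :: "real^'n::finite \<Rightarrow> complex"
  assumes "closure {x. \<psi> x \<noteq> 0} \<subseteq> ball 0 1" "\<And>x. norm (\<psi> x) \<le> B" "t > 0"
  shows "norm (dil t \<psi> (x - y)) \<le> B / t ^ CARD('n) * indicator (ball x t) y"
proof (cases "y \<in> ball x t")
  case True
  then show ?thesis
    using assms(2)[of "(1 / t) *\<^sub>R (x - y)"] assms(3)
    by (simp add: dil_def norm_mult norm_divide norm_power divide_right_mono)
next
  case False
  then show ?thesis using dil_eq_0[OF assms(1,3), of "x - y"] by (simp add: dist_norm)
qed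

text \<open>Dividing by \<open>weight \<tau>1 \<tau>2 x\<close> before integrating spares the measurability of the
  integrand of \<open>Qint\<close> in the scale variables.\<close>

lemma weight_Qint_le:
  fixes \<psi>1 \<phi>1 :: "real^'n1::finite \<Rightarrow> complex"
    and \<psi>2 \<phi>2 :: "real^'n2::finite \<Rightarrow> complex"
  assumes conv: "\<And>t1 t2 y. t1 > 0 \<Longrightarrow> t2 > 0 \<Longrightarrow>
      norm (conv (dil2 t1 t2 \<phi>1 \<phi>2) f y) \<le> C * decay_kernel N1 t1 (fst y) * decay_kernel N2 t2 (snd y)"
    and \<psi>1: "closure {x. \<psi>1 x \<noteq> 0} \<subseteq> ball 0 1" "\<And>x. norm (\<psi>1 x) \<le> B1"
    and \<psi>2: "closure {x. \<psi>2 x \<noteq> 0} \<subseteq> ball 0 1" "\<And>x. norm (\<psi>2 x) \<le> B2"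
    and nonneg: "C \<ge> 0" "B1 \<ge> 0" "B2 \<ge> 0"
    and \<tau>: "0 \<le> \<tau>1" "\<tau>1 \<le> real N1" "0 \<le> \<tau>2" "\<tau>2 \<le> real N2"
    and A1 [measurable]: "A1 \<in> sets borel" and A2 [measurable]: "A2 \<in> sets borel"
    and A_pos: "A1 \<subseteq> {0<..}" "A2 \<subseteq> {0<..}"
  shows "ennreal (weight \<tau>1 \<tau>2 x) * Qint \<psi>1 \<psi>2 \<phi>1 \<phi>2 f A1 A2 Y x \<le>
    ennreal (C * 2 ^ N1 * 2 ^ N2 * B1 * B2 * unit_ball_vol (real CARD('n1)) * unit_ball_vol (real CARD('n2)))
      * scale_integral \<tau>1 N1 A1 * scale_integral \<tau>2 N2 A2"
proof -
  obtain x1 x2 where x: "x = (x1, x2)" by (cases x)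
  define W where "W = weight \<tau>1 \<tau>2 x"
  have W: "W > 0" unfolding W_def weight_def by (intro mult_pos_pos) (simp_all add: add_pos_nonneg add_nonneg_eq_0_iff)
  define V where "V = unit_ball_vol (real CARD('n1)) * unit_ball_vol (real CARD('n2))"
  have V: "V \<ge> 0" by (simp add: V_def unit_ball_vol_nonneg)
  define M where "M = C * 2 ^ N1 * 2 ^ N2 * B1 * B2 / W"
  have M: "M \<ge> 0" using nonneg W by (simp add: M_def)
  let ?w1 = "scale_weight \<tau>1 N1" and ?w2 = "scale_weight \<tau>2 N2"
  define I where "I t1 t2 = (\<integral>\<^sup>+ y\<in>Y. ennreal (norm (Defs.conv (dil2 t1 t2 \<phi>1 \<phi>2) f y) *
      norm (dil2 t1 t2 \<psi>1 \<psi>2 (x - y))) \<partial>lborel)" for t1 t2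
  have I: "I t1 t2 \<le> ennreal (M * V * ?w1 t1 * ?w2 t2)" if t: "t1 > 0" "t2 > 0" for t1 t2
  proof -
    let ?T1 = "t1 ^ CARD('n1)" and ?T2 = "t2 ^ CARD('n2)"
    \<comment> \<open>The denominators come from the normalisation of the dilates of
      \<open>\<psi>1\<close> and \<open>\<psi>2\<close>; the volumes of the two balls cancel
      them.\<close>
    let ?c = "M * ?w1 t1 * ?w2 t2 / (?T1 * ?T2)"
    have c0: "?c \<ge> 0" using M t by (simp add: scale_weight_nonneg)
    have pw: "norm (Defs.conv (dil2 t1 t2 \<phi>1 \<phi>2) f y) * norm (dil2 t1 t2 \<psi>1 \<psi>2 (x - y)) \<le>
        ?c * indicator (ball x1 t1 \<times> ball x2 t2) y" for y
    proof (cases "y \<in> ball x1 t1 \<times> ball x2 t2")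
      case True
      then have d: "norm (x1 - fst y) < t1" "norm (x2 - snd y) < t2"
        by (auto simp: dist_norm)
      have "norm (Defs.conv (dil2 t1 t2 \<phi>1 \<phi>2) f y) \<le>
          C * decay_kernel N1 t1 (fst y) * decay_kernel N2 t2 (snd y)"
        by (rule conv) (use t in auto)
      also have "\<dots> \<le> C * (2 ^ N1 * ?w1 t1 / (1 + norm x1) powr \<tau>1) * (2 ^ N2 * ?w2 t2 / (1 + norm x2) powr \<tau>2)"
        using t d \<tau> nonneg
        by (intro mult_mono decay_kernel_le_scale_weight decay_kernel_nonneg mult_nonneg_nonneg)
          (auto simp: scale_weight_nonneg)
      finally have 1: "norm (Defs.conv (dil2 t1 t2 \<phi>1 \<phi>2) f y) \<le>
          C * (2 ^ N1 * ?w1 t1 / (1 + norm x1) powr \<tau>1) * (2 ^ N2 * ?w2 t2 / (1 + norm x2) powr \<tau>2)" .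
      have "norm (dil t1 \<psi>1 (x1 - fst y)) \<le> B1 / ?T1" "norm (dil t2 \<psi>2 (x2 - snd y)) \<le> B2 / ?T2"
        using norm_dil_le[OF \<psi>1 t(1), of x1 "fst y"] norm_dil_le[OF \<psi>2 t(2), of x2 "snd y"] True
        by (auto simp: indicator_def)
      then have "norm (dil2 t1 t2 \<psi>1 \<psi>2 (x - y)) \<le> B1 / ?T1 * (B2 / ?T2)"
        unfolding dil2_def x using t nonneg by (simp only: norm_mult fst_diff snd_diff fst_conv snd_conv)
          (intro mult_mono, auto)
      with 1 have "norm (Defs.conv (dil2 t1 t2 \<phi>1 \<phi>2) f y) * norm (dil2 t1 t2 \<psi>1 \<psi>2 (x - y)) \<le>
          (C * (2 ^ N1 * ?w1 t1 / (1 + norm x1) powr \<tau>1) * (2 ^ N2 * ?w2 t2 / (1 + norm x2) powr \<tau>2)) *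
          (B1 / ?T1 * (B2 / ?T2))"
        using t nonneg by (intro mult_mono) (auto simp: scale_weight_nonneg)
      also have "\<dots> = ?c" by (simp add: M_def W_def weight_def x)
      finally show ?thesis using True by simp
    next
      case False
      then have "dil t1 \<psi>1 (x1 - fst y) = 0 \<or> dil t2 \<psi>2 (x2 - snd y) = 0"
        using dil_eq_0[OF \<psi>1(1) t(1), of "x1 - fst y"] dil_eq_0[OF \<psi>2(1) t(2), of "x2 - snd y"]
        by (cases y) (auto simp: dist_norm not_less)
      then show ?thesis by (auto simp: dil2_def x False)
    qed
    \<comment> \<open>The indicator of \<open>Y\<close> is bounded by \<open>1\<close>, and what
      remains is the measure of a product of two balls.\<close>
    have "I t1 t2 \<le> (\<integral>\<^sup>+ y. ennreal ?c * indicator (ball x1 t1 \<times> ball x2 t2) y \<partial>(lborel \<Otimes>\<^sub>M lborel))"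
      unfolding I_def lborel_prod
    proof (rule nn_integral_mono)
      fix y
      have "ennreal (norm (Defs.conv (dil2 t1 t2 \<phi>1 \<phi>2) f y) * norm (dil2 t1 t2 \<psi>1 \<psi>2 (x - y))) * indicator Y y
          \<le> ennreal (?c * indicator (ball x1 t1 \<times> ball x2 t2) y) * 1"
        by (intro mult_mono ennreal_leI pw) (auto simp: indicator_def)
      also have "\<dots> = ennreal ?c * indicator (ball x1 t1 \<times> ball x2 t2) y"
        by (auto simp: indicator_def)
      finally show "ennreal (norm (Defs.conv (dil2 t1 t2 \<phi>1 \<phi>2) f y) * norm (dil2 t1 t2 \<psi>1 \<psi>2 (x - y))) * indicator Y y
          \<le> ennreal ?c * indicator (ball x1 t1 \<times> ball x2 t2) y" .
    qed
    also have "\<dots> = ennreal ?c * (emeasure lborel (ball x1 t1) * emeasure lborel (ball x2 t2))"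
      by (subst nn_integral_cmult_indicator) (auto simp: lborel.emeasure_pair_measure_Times)
    also have "\<dots> = ennreal (?c * ((unit_ball_vol (real CARD('n1)) * ?T1) * (unit_ball_vol (real CARD('n2)) * ?T2)))"
    proof -
      have "emeasure lborel (ball x1 t1) = ennreal (unit_ball_vol (real CARD('n1)) * ?T1)"
          "emeasure lborel (ball x2 t2) = ennreal (unit_ball_vol (real CARD('n2)) * ?T2)"
        using t by (simp_all add: emeasure_ball)
      moreover have "unit_ball_vol (real CARD('n1)) * ?T1 \<ge> 0" "unit_ball_vol (real CARD('n2)) * ?T2 \<ge> 0"
        using t by (simp_all add: unit_ball_vol_nonneg)
      ultimately show ?thesis using c0 by (simp only: ennreal_mult mult_nonneg_nonneg)
    qed
    also have "?c * ((unit_ball_vol (real CARD('n1)) * ?T1) * (unit_ball_vol (real CARD('n2)) * ?T2)) =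
        M * V * ?w1 t1 * ?w2 t2"
      using t by (simp add: V_def)
    finally show ?thesis .
  qed
  define S2 where "S2 = scale_integral \<tau>2 N2 A2"
  have J: "(\<integral>\<^sup>+ t2\<in>A2. I t1 t2 * ennreal (1 / t2) \<partial>lborel) \<le> ennreal (M * V * ?w1 t1) * S2" if t1: "t1 > 0" for t1
  proof -
    have "(\<integral>\<^sup>+ t2\<in>A2. I t1 t2 * ennreal (1 / t2) \<partial>lborel) \<le>
        (\<integral>\<^sup>+ t2. ennreal (M * V * ?w1 t1) * (ennreal (?w2 t2 / t2) * indicator A2 t2) \<partial>lborel)"
    proof (rule nn_integral_mono)
      fix t2
      show "I t1 t2 * ennreal (1 / t2) * indicator A2 t2 \<le>
          ennreal (M * V * ?w1 t1) * (ennreal (?w2 t2 / t2) * indicator A2 t2)"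
      proof (cases "t2 \<in> A2")
        case True
        then have t2: "t2 > 0" using A_pos by auto
        have "I t1 t2 * ennreal (1 / t2) \<le> ennreal (M * V * ?w1 t1 * ?w2 t2) * ennreal (1 / t2)"
          by (intro mult_right_mono I t1 t2) simp
        also have "\<dots> = ennreal (M * V * ?w1 t1) * ennreal (?w2 t2 / t2)"
          using t1 t2 M V by (simp add: scale_weight_nonneg flip: ennreal_mult)
        finally show ?thesis using True by simp
      qed simp
    qed
    also have "\<dots> = ennreal (M * V * ?w1 t1) * S2"
      unfolding S2_def scale_integral_def by (rule nn_integral_cmult) measurable
    finally show ?thesis .
  qed
  have "Qint \<psi>1 \<psi>2 \<phi>1 \<phi>2 f A1 A2 Y x =
      (\<integral>\<^sup>+ t1\<in>A1. (\<integral>\<^sup>+ t2\<in>A2. I t1 t2 * ennreal (1 / t2) \<partial>lborel) * ennreal (1 / t1) \<partial>lborel)"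
    unfolding Qint_def I_def ..
  also have "\<dots> \<le> (\<integral>\<^sup>+ t1. (ennreal (M * V) * S2) * (ennreal (?w1 t1 / t1) * indicator A1 t1) \<partial>lborel)"
  proof (rule nn_integral_mono)
    fix t1
    show "(\<integral>\<^sup>+ t2\<in>A2. I t1 t2 * ennreal (1 / t2) \<partial>lborel) * ennreal (1 / t1) * indicator A1 t1 \<le>
        (ennreal (M * V) * S2) * (ennreal (?w1 t1 / t1) * indicator A1 t1)"
    proof (cases "t1 \<in> A1")
      case True
      then have t1: "t1 > 0" using A_pos by auto
      have "(\<integral>\<^sup>+ t2\<in>A2. I t1 t2 * ennreal (1 / t2) \<partial>lborel) * ennreal (1 / t1) \<le>
          ennreal (M * V * ?w1 t1) * S2 * ennreal (1 / t1)"
        by (intro mult_right_mono J t1) simp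
      also have "\<dots> = (ennreal (M * V * ?w1 t1) * ennreal (1 / t1)) * S2" by (simp only: mult_ac)
      also have "ennreal (M * V * ?w1 t1) * ennreal (1 / t1) = ennreal (M * V) * ennreal (?w1 t1 / t1)"
        using t1 M V by (simp add: scale_weight_nonneg flip: ennreal_mult)
      finally show ?thesis using True by (simp add: mult_ac)
    qed simp
  qed
  also have "\<dots> = (ennreal (M * V) * S2) * scale_integral \<tau>1 N1 A1"
    unfolding scale_integral_def by (rule nn_integral_cmult) measurable
  finally have "ennreal W * Qint \<psi>1 \<psi>2 \<phi>1 \<phi>2 f A1 A2 Y x \<le>
      ennreal W * ((ennreal (M * V) * S2) * scale_integral \<tau>1 N1 A1)"
    by (rule mult_left_mono) simp
  also have "\<dots> = ennreal (W * (M * V)) * scale_integral \<tau>1 N1 A1 * S2"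
    using W M V by (simp add: ennreal_mult mult_ac)
  also have "W * (M * V) = C * 2 ^ N1 * 2 ^ N2 * B1 * B2 * unit_ball_vol (real CARD('n1)) * unit_ball_vol (real CARD('n2))"
    using W by (simp add: M_def V_def)
  finally show ?thesis by (simp add: W_def S2_def)
qed

section \<open>The weighted estimates\<close>

text \<open>The integral is the Fourier transform at the origin, which lies outside the annulus
  containing the support.\<close>

lemma cond_pair_mean_zero:
  assumes "cond_pair \<psi> \<phi>"
  shows "(\<integral>x. \<phi> x \<partial>lborel) = 0"
proof -
  have "0 \<notin> closure {\<xi>. fourier \<phi> \<xi> \<noteq> 0}"
    using assms unfolding cond_pair_def by auto
  then have "fourier \<phi> 0 = 0" by (rule eq_0_if_notin_closure_support)
  then show ?thesis by (simp add: fourier_def)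
qed

lemma Dspace_bounded:
  assumes "\<psi> \<in> Dspace s"
  obtains B where "B \<ge> 0" "\<And>x. norm (\<psi> x) \<le> B"
proof -
  have "smooth_fun \<psi>" "compact (closure {x. \<psi> x \<noteq> 0})"
    using assms by (simp_all add: Dspace_def compact_supp_def)
  then show ?thesis
  proof (rule smooth_compact_supp_bounded[where vs="[]"])
    show "\<psi> x = 0" if "x \<notin> closure {x. \<psi> x \<noteq> 0}" for x
      using that by (rule eq_0_if_notin_closure_support)
    show thesis if "B \<ge> 0" "\<And>x. norm (dderiv [] \<psi> x) \<le> B" for B
      using \<open>\<And>B. B \<ge> 0 \<Longrightarrow> (\<And>x. norm (\<psi> x) \<le> B) \<Longrightarrow> thesis\<close> that by simp
  qed
qed

lemma nn_integral_eq_0I: "(\<And>x. f x = 0) \<Longrightarrow> integral\<^sup>N M f = 0"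
  by (subst nn_integral_cong[where v="\<lambda>_. 0"]) auto

text \<open>If \<open>norm (fst x) < L\<close> and \<open>norm (fst y) \<ge> 2 * L\<close>, the
  first components are more than \<open>L > t1\<close> apart, beyond the support of the dilate of
  \<open>\<psi>1\<close>.\<close>

lemma Qint_eq_0_fst:
  assumes "closure {x. \<psi>1 x \<noteq> 0} \<subseteq> ball 0 1" "norm (fst x) < L"
  shows "Qint \<psi>1 \<psi>2 \<phi>1 \<phi>2 f {0<..<L} A2 {y. 2 * L \<le> norm (fst y)} x = 0"
proof -
  have "dil2 t1 t2 \<psi>1 \<psi>2 (x - y) = 0" if "0 < t1" "t1 < L" "2 * L \<le> norm (fst y)" for t1 t2 y
    using that assms(2) norm_triangle_ineq2[of "fst y" "fst x"]
      dil_eq_0[OF assms(1) that(1), of "fst x - fst y"]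
    by (simp add: dil2_def norm_minus_commute)
  then have "(\<integral>\<^sup>+ y. ennreal (norm (conv (dil2 t1 t2 \<phi>1 \<phi>2) f y) * norm (dil2 t1 t2 \<psi>1 \<psi>2 (x - y))) *
      indicator {y. 2 * L \<le> norm (fst y)} y \<partial>lborel) = 0" if "0 < t1" "t1 < L" for t1 t2
    using that by (intro nn_integral_eq_0I) (auto simp: indicator_def)
  then show ?thesis
    unfolding Qint_def by (intro nn_integral_eq_0I) (auto simp: indicator_def)
qed

lemma Qint_eq_0_snd:
  assumes "closure {x. \<psi>2 x \<noteq> 0} \<subseteq> ball 0 1" "norm (snd x) < L"
  shows "Qint \<psi>1 \<psi>2 \<phi>1 \<phi>2 f A1 {0<..<L} {y. 2 * L \<le> norm (snd y)} x = 0"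
proof -
  have "dil2 t1 t2 \<psi>1 \<psi>2 (x - y) = 0" if "0 < t2" "t2 < L" "2 * L \<le> norm (snd y)" for t1 t2 y
    using that assms(2) norm_triangle_ineq2[of "snd y" "snd x"]
      dil_eq_0[OF assms(1) that(1), of "snd x - snd y"]
    by (simp add: dil2_def norm_minus_commute)
  then have "(\<integral>\<^sup>+ y. ennreal (norm (conv (dil2 t1 t2 \<phi>1 \<phi>2) f y) * norm (dil2 t1 t2 \<psi>1 \<psi>2 (x - y))) *
      indicator {y. 2 * L \<le> norm (snd y)} y \<partial>lborel) = 0" if "0 < t2" "t2 < L" for t1 t2
    using that by (intro nn_integral_eq_0I) (auto simp: indicator_def)
  \<comment> \<open>The scale restriction now sits in the inner integral, which therefore vanishes
    for every \<open>t1\<close>.\<close>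
  then have "(\<integral>\<^sup>+ t2\<in>{0<..<L}. (\<integral>\<^sup>+ y. ennreal (norm (conv (dil2 t1 t2 \<phi>1 \<phi>2) f y) *
      norm (dil2 t1 t2 \<psi>1 \<psi>2 (x - y))) * indicator {y. 2 * L \<le> norm (snd y)} y \<partial>lborel) *
      ennreal (1 / t2) \<partial>lborel) = 0" for t1
    by (intro nn_integral_eq_0I) (auto simp: indicator_def)
  then show ?thesis
    unfolding Qint_def by simp
qed

text \<open>Source of the gain in the last two estimates: away from the ball of radius
  \<open>L\<close>, raising the weight exponent from \<open>\<sigma>\<close> to
  \<open>\<sigma>'\<close> gains \<open>L powr (\<sigma> - \<sigma>')\<close>.\<close>

lemma powr_1_plus_le:
  fixes r L :: real
  assumes "1 \<le> L" "L \<le> r" "\<sigma> \<le> \<sigma>'"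
  shows "(1 + r) powr \<sigma> \<le> L powr (\<sigma> - \<sigma>') * (1 + r) powr \<sigma>'"
proof -
  have "(1 + r) powr (\<sigma> - \<sigma>') \<le> L powr (\<sigma> - \<sigma>')"
    using assms by (intro powr_mono2') auto
  then have "(1 + r) powr (\<sigma> - \<sigma>') * (1 + r) powr \<sigma>' \<le> L powr (\<sigma> - \<sigma>') * (1 + r) powr \<sigma>'"
    by (rule mult_right_mono) simp
  then show ?thesis by (simp flip: powr_add)
qed

text \<open>The bound \<open>1 + 1 / (real N - \<tau>)\<close> for all scales also dominates the
  constants \<open>1\<close> and \<open>1 / (real N - \<tau>)\<close> of the two tails, so a single
  \<open>G\<close> serves.\<close>

lemma scale_integral_bounds:
  assumes "\<tau> < real N"
  obtains G where "G \<ge> 0" "scale_integral \<tau> N {0<..} \<le> ennreal G"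
    "\<And>\<epsilon>. 0 < \<epsilon> \<Longrightarrow> \<epsilon> < 1 \<Longrightarrow> scale_integral \<tau> N {0<..<\<epsilon>} \<le> ennreal (G * \<epsilon>)"
    "\<And>L. 1 < L \<Longrightarrow> scale_integral \<tau> N {L<..} \<le> ennreal (G * L powr (\<tau> - real N))"
proof (rule that[of "1 + 1 / (real N - \<tau>)"])
  let ?G = "1 + 1 / (real N - \<tau>)"
  show G: "?G \<ge> 0" using assms by simp
  show "scale_integral \<tau> N {0<..} \<le> ennreal ?G" by (rule scale_integral_all[OF assms])
  show "scale_integral \<tau> N {0<..<\<epsilon>} \<le> ennreal (?G * \<epsilon>)" if "0 < \<epsilon>" "\<epsilon> < 1" for \<epsilon>
  proof -
    have "1 * \<epsilon> \<le> ?G * \<epsilon>" using assms that by (intro mult_right_mono) auto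
    then show ?thesis
      using scale_integral_small[of \<epsilon> \<tau> N] that by (simp add: order_trans[OF _ ennreal_leI])
  qed
  show "scale_integral \<tau> N {L<..} \<le> ennreal (?G * L powr (\<tau> - real N))" if "1 < L" for L
  proof -
    have "scale_integral \<tau> N {L<..} \<le> scale_integral \<tau> N {L..}"
      by (rule scale_integral_mono) auto
    also have "\<dots> \<le> ennreal (L powr (\<tau> - real N) / (real N - \<tau>))"
      using assms that by (intro scale_integral_large) auto
    also have "\<dots> \<le> ennreal (?G * L powr (\<tau> - real N))"
      by (intro ennreal_leI) (simp add: distrib_right)
    finally show ?thesis .
  qed
qed

theorem lemma2p1:
  fixes \<psi>1 \<phi>1 :: "real^'n1::finite \<Rightarrow> complex"
    and \<psi>2 \<phi>2 :: "real^'n2::finite \<Rightarrow> complex"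
    and s1 s2 :: nat
    and \<sigma>1 \<sigma>2 \<sigma>1' \<sigma>2' :: real
    and f :: "(real^'n1) \<times> (real^'n2) \<Rightarrow> complex"
  assumes "\<psi>1 \<in> Dspace s1" and "\<psi>2 \<in> Dspace s2"
    and "schwartz \<phi>1" and "schwartz \<phi>2"
    and "cond_pair \<psi>1 \<phi>1" and "cond_pair \<psi>2 \<phi>2"
    and "0 < \<sigma>1" "\<sigma>1 < \<sigma>1'" "\<sigma>1' < real (CARD('n1) + s1 + 1)"
    and "0 < \<sigma>2" "\<sigma>2 < \<sigma>2'" "\<sigma>2' < real (CARD('n2) + s2 + 1)"
    and "f \<in> Dspace2 s1 s2"
  shows "\<exists>C>0. \<forall>\<epsilon>1 \<epsilon>2 L1 L2. 0 < \<epsilon>1 \<and> \<epsilon>1 < 1 \<and> 0 < \<epsilon>2 \<and> \<epsilon>2 < 1 \<and> 1 < L1 \<and> 1 < L2 \<longrightarrow>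
      (SUP x. ennreal (weight \<sigma>1 \<sigma>2 x) *
          (Qint \<psi>1 \<psi>2 \<phi>1 \<phi>2 f {0<..<\<epsilon>1} {0<..} UNIV x
         + Qint \<psi>1 \<psi>2 \<phi>1 \<phi>2 f {L1<..} {0<..} UNIV x
         + Qint \<psi>1 \<psi>2 \<phi>1 \<phi>2 f {0<..} {0<..<\<epsilon>2} UNIV x
         + Qint \<psi>1 \<psi>2 \<phi>1 \<phi>2 f {0<..} {L2<..} UNIV x))
        \<le> ennreal (C * (\<epsilon>1 + \<epsilon>2 + L1 powr (\<sigma>1 - real CARD('n1) - real s1 - 1)
                              + L2 powr (\<sigma>2 - real CARD('n2) - real s2 - 1)))
    \<and> (SUP x. ennreal (weight \<sigma>1 \<sigma>2 x) *
          Qint \<psi>1 \<psi>2 \<phi>1 \<phi>2 f {0<..<L1} {0<..} {y. 2 * L1 \<le> norm (fst y)} x)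
        \<le> ennreal (C * L1 powr (\<sigma>1 - \<sigma>1'))
    \<and> (SUP x. ennreal (weight \<sigma>1 \<sigma>2 x) *
          Qint \<psi>1 \<psi>2 \<phi>1 \<phi>2 f {0<..} {0<..<L2} {y. 2 * L2 \<le> norm (snd y)} x)
        \<le> ennreal (C * L2 powr (\<sigma>2 - \<sigma>2'))"
proof -
  let ?N1 = "CARD('n1) + s1 + 1" and ?N2 = "CARD('n2) + s2 + 1"
  note cp = assms(5,6)
  have supp: "closure {x. \<psi>1 x \<noteq> 0} \<subseteq> ball 0 1" "closure {x. \<psi>2 x \<noteq> 0} \<subseteq> ball 0 1"
    using cp unfolding cond_pair_def by blast+
  obtain B1 where B1: "B1 \<ge> 0" "\<And>x. norm (\<psi>1 x) \<le> B1" using Dspace_bounded[OF assms(1)] by metis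
  obtain B2 where B2: "B2 \<ge> 0" "\<And>x. norm (\<psi>2 x) \<le> B2" using Dspace_bounded[OF assms(2)] by metis
  obtain C where C: "C \<ge> 0" "\<And>t1 t2 y. t1 > 0 \<Longrightarrow> t2 > 0 \<Longrightarrow> norm (conv (dil2 t1 t2 \<phi>1 \<phi>2) f y) \<le>
      C * decay_kernel ?N1 t1 (fst y) * decay_kernel ?N2 t2 (snd y)"
    using conv_dil2_bound[OF assms(13) assms(3) cond_pair_mean_zero[OF cp(1)] assms(4) cond_pair_mean_zero[OF cp(2)]]
    by metis
  define K where "K = C * 2 ^ ?N1 * 2 ^ ?N2 * B1 * B2 * unit_ball_vol (real CARD('n1)) * unit_ball_vol (real CARD('n2))"
  have K: "K \<ge> 0" using B1(1) B2(1) C(1) by (simp add: K_def unit_ball_vol_nonneg)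
  \<comment> \<open>One estimate for all six integrals; only the exponents, the sets of scales and
    the region \<open>Y\<close> vary.\<close>
  have Q: "ennreal (weight \<tau>1 \<tau>2 x) * Qint \<psi>1 \<psi>2 \<phi>1 \<phi>2 f A1 A2 Y x \<le> ennreal (K * a * b)"
    if "0 \<le> \<tau>1" "\<tau>1 \<le> real ?N1" "0 \<le> \<tau>2" "\<tau>2 \<le> real ?N2" "A1 \<in> sets borel" "A2 \<in> sets borel"
      "A1 \<subseteq> {0<..}" "A2 \<subseteq> {0<..}" and ab: "scale_integral \<tau>1 ?N1 A1 \<le> ennreal a"
      "scale_integral \<tau>2 ?N2 A2 \<le> ennreal b" "a \<ge> 0" "b \<ge> 0"
    for \<tau>1 \<tau>2 A1 A2 Y x a b
  proof -
    have "ennreal (weight \<tau>1 \<tau>2 x) * Qint \<psi>1 \<psi>2 \<phi>1 \<phi>2 f A1 A2 Y x \<le>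
        ennreal K * scale_integral \<tau>1 ?N1 A1 * scale_integral \<tau>2 ?N2 A2"
      unfolding K_def using weight_Qint_le[OF C(2) supp(1) B1(2) supp(2) B2(2) C(1) B1(1) B2(1) that(1-8)] .
    also have "\<dots> \<le> ennreal K * ennreal a * ennreal b"
      using ab by (intro mult_mono) auto
    also have "\<dots> = ennreal (K * a * b)" using K ab by (simp add: ennreal_mult)
    finally show ?thesis .
  qed
  have \<sigma>: "0 \<le> \<sigma>1" "\<sigma>1 < real ?N1" "0 \<le> \<sigma>2" "\<sigma>2 < real ?N2" "0 \<le> \<sigma>1'" "0 \<le> \<sigma>2'"
    using assms by auto
  obtain G1 where G1: "G1 \<ge> 0" "scale_integral \<sigma>1 ?N1 {0<..} \<le> ennreal G1"
    "\<And>\<epsilon>. 0 < \<epsilon> \<Longrightarrow> \<epsilon> < 1 \<Longrightarrow> scale_integral \<sigma>1 ?N1 {0<..<\<epsilon>} \<le> ennreal (G1 * \<epsilon>)"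
    "\<And>L. 1 < L \<Longrightarrow> scale_integral \<sigma>1 ?N1 {L<..} \<le> ennreal (G1 * L powr (\<sigma>1 - real ?N1))"
    using scale_integral_bounds[OF \<sigma>(2)] by metis
  obtain G2 where G2: "G2 \<ge> 0" "scale_integral \<sigma>2 ?N2 {0<..} \<le> ennreal G2"
    "\<And>\<epsilon>. 0 < \<epsilon> \<Longrightarrow> \<epsilon> < 1 \<Longrightarrow> scale_integral \<sigma>2 ?N2 {0<..<\<epsilon>} \<le> ennreal (G2 * \<epsilon>)"
    "\<And>L. 1 < L \<Longrightarrow> scale_integral \<sigma>2 ?N2 {L<..} \<le> ennreal (G2 * L powr (\<sigma>2 - real ?N2))"
    using scale_integral_bounds[OF \<sigma>(4)] by metis
  \<comment> \<open>For the last two estimates one exponent is raised to \<open>\<sigma>1'\<close>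
    or \<open>\<sigma>2'\<close>, still below the kernel exponent, so the integral over all scales
    stays finite.\<close>
  obtain H1 where H1: "H1 \<ge> 0" "scale_integral \<sigma>1' ?N1 {0<..} \<le> ennreal H1"
    using scale_integral_bounds[OF assms(9)] by metis
  obtain H2 where H2: "H2 \<ge> 0" "scale_integral \<sigma>2' ?N2 {0<..} \<le> ennreal H2"
    using scale_integral_bounds[OF assms(12)] by metis
  \<comment> \<open>The three products belong to the three estimates in order; the summand
    \<open>1\<close> ensures positivity.\<close>
  define D where "D = 1 + K * G1 * G2 + K * H1 * G2 + K * G1 * H2"
  have nn: "0 \<le> K * G1 * G2" "0 \<le> K * H1 * G2" "0 \<le> K * G1 * H2"
    using K G1(1) G2(1) H1(1) H2(1) by auto
  have D: "D > 0" "K * G1 * G2 * r \<le> D * r" "K * H1 * G2 * r \<le> D * r" "K * G1 * H2 * r \<le> D * r"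
    if "r \<ge> 0" for r
    using nn that by (auto simp: D_def intro!: mult_right_mono)
  show ?thesis
  proof (intro exI[of _ D] conjI allI impI SUP_least)
    show "D > 0" using D(1)[of 0] by simp
    fix \<epsilon>1 \<epsilon>2 L1 L2 :: real and x :: "(real^'n1) \<times> (real^'n2)"
    assume "0 < \<epsilon>1 \<and> \<epsilon>1 < 1 \<and> 0 < \<epsilon>2 \<and> \<epsilon>2 < 1 \<and> 1 < L1 \<and> 1 < L2"
    then have \<epsilon>L: "0 < \<epsilon>1" "\<epsilon>1 < 1" "0 < \<epsilon>2" "\<epsilon>2 < 1" "1 < L1" "1 < L2" by auto
    have sub: "{0<..<L} \<subseteq> {0<..}" for L :: real by auto
    let ?Q = "Qint \<psi>1 \<psi>2 \<phi>1 \<phi>2 f" and ?w = "ennreal (weight \<sigma>1 \<sigma>2 x)"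
    let ?l1 = "L1 powr (\<sigma>1 - real ?N1)" and ?l2 = "L2 powr (\<sigma>2 - real ?N2)"
    have "?w * ?Q {0<..<\<epsilon>1} {0<..} UNIV x \<le> ennreal (K * (G1 * \<epsilon>1) * G2)"
      using \<epsilon>L \<sigma> G1 G2 by (intro Q) auto
    moreover have "?w * ?Q {L1<..} {0<..} UNIV x \<le> ennreal (K * (G1 * ?l1) * G2)"
      using \<epsilon>L \<sigma> G1(1) G1(4)[of L1] G2(1,2) by (intro Q) auto
    moreover have "?w * ?Q {0<..} {0<..<\<epsilon>2} UNIV x \<le> ennreal (K * G1 * (G2 * \<epsilon>2))"
      using \<epsilon>L \<sigma> G1 G2 by (intro Q) auto
    moreover have "?w * ?Q {0<..} {L2<..} UNIV x \<le> ennreal (K * G1 * (G2 * ?l2))"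
      using \<epsilon>L \<sigma> G1(1,2) G2(1) G2(4)[of L2] by (intro Q) auto
    ultimately have "?w * (?Q {0<..<\<epsilon>1} {0<..} UNIV x + ?Q {L1<..} {0<..} UNIV x
        + ?Q {0<..} {0<..<\<epsilon>2} UNIV x + ?Q {0<..} {L2<..} UNIV x)
      \<le> ennreal (K * (G1 * \<epsilon>1) * G2) + ennreal (K * (G1 * ?l1) * G2)
        + ennreal (K * G1 * (G2 * \<epsilon>2)) + ennreal (K * G1 * (G2 * ?l2))"
      unfolding distrib_left by (intro add_mono)
    also have "\<dots> = ennreal (K * G1 * G2 * (\<epsilon>1 + \<epsilon>2 + ?l1 + ?l2))"
      using K G1(1) G2(1) \<epsilon>L by (simp flip: ennreal_plus add: algebra_simps)
    also have "\<dots> \<le> ennreal (D * (\<epsilon>1 + \<epsilon>2 + ?l1 + ?l2))"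
      using \<epsilon>L by (intro ennreal_leI D) auto
    finally show "?w * (?Q {0<..<\<epsilon>1} {0<..} UNIV x + ?Q {L1<..} {0<..} UNIV x
        + ?Q {0<..} {0<..<\<epsilon>2} UNIV x + ?Q {0<..} {L2<..} UNIV x)
      \<le> ennreal (D * (\<epsilon>1 + \<epsilon>2 + L1 powr (\<sigma>1 - real CARD('n1) - real s1 - 1)
                              + L2 powr (\<sigma>2 - real CARD('n2) - real s2 - 1)))"
      by (simp add: algebra_simps)
    \<comment> \<open>For \<open>norm (fst x) < L1\<close> the integral vanishes. Otherwise the
      weight with \<open>\<sigma>1\<close> is traded for the one with \<open>\<sigma>1'\<close>,
      while \<open>\<sigma>2\<close> is kept.\<close>
    show "?w * ?Q {0<..<L1} {0<..} {y. 2 * L1 \<le> norm (fst y)} x \<le> ennreal (D * L1 powr (\<sigma>1 - \<sigma>1'))"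
    proof (cases "norm (fst x) < L1")
      case True
      then show ?thesis using Qint_eq_0_fst[OF supp(1) True] by simp
    next
      case False
      let ?q = "?Q {0<..<L1} {0<..} {y. 2 * L1 \<le> norm (fst y)} x"
      have "weight \<sigma>1 \<sigma>2 x \<le> L1 powr (\<sigma>1 - \<sigma>1') * weight \<sigma>1' \<sigma>2 x"
        unfolding weight_def mult.assoc[symmetric]
        using False assms(8) \<epsilon>L by (intro mult_right_mono powr_1_plus_le) auto
      then have "?w * ?q \<le> ennreal (L1 powr (\<sigma>1 - \<sigma>1') * weight \<sigma>1' \<sigma>2 x) * ?q"
        by (intro mult_right_mono ennreal_leI) auto
      also have "\<dots> = ennreal (L1 powr (\<sigma>1 - \<sigma>1')) * (ennreal (weight \<sigma>1' \<sigma>2 x) * ?q)"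
        by (simp add: ennreal_mult weight_def mult.assoc)
      also have "\<dots> \<le> ennreal (L1 powr (\<sigma>1 - \<sigma>1')) * ennreal (K * H1 * G2)"
        using \<sigma> assms(9) H1 G2(1,2) order_trans[OF scale_integral_mono[OF sub] H1(2), of L1]
        by (intro mult_left_mono Q) auto
      also have "\<dots> = ennreal (K * H1 * G2 * L1 powr (\<sigma>1 - \<sigma>1'))"
        using nn by (simp add: ennreal_mult mult.commute)
      also have "\<dots> \<le> ennreal (D * L1 powr (\<sigma>1 - \<sigma>1'))"
        by (intro ennreal_leI D) simp
      finally show ?thesis .
    qed
    show "?w * ?Q {0<..} {0<..<L2} {y. 2 * L2 \<le> norm (snd y)} x \<le> ennreal (D * L2 powr (\<sigma>2 - \<sigma>2'))"
    proof (cases "norm (snd x) < L2")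
      case True
      then show ?thesis using Qint_eq_0_snd[OF supp(2) True] by simp
    next
      case False
      let ?q = "?Q {0<..} {0<..<L2} {y. 2 * L2 \<le> norm (snd y)} x"
      have "weight \<sigma>1 \<sigma>2 x \<le> L2 powr (\<sigma>2 - \<sigma>2') * weight \<sigma>1 \<sigma>2' x"
        unfolding weight_def mult.left_commute[of "L2 powr _"]
        using False assms(11) \<epsilon>L by (intro mult_left_mono powr_1_plus_le) auto
      then have "?w * ?q \<le> ennreal (L2 powr (\<sigma>2 - \<sigma>2') * weight \<sigma>1 \<sigma>2' x) * ?q"
        by (intro mult_right_mono ennreal_leI) auto
      also have "\<dots> = ennreal (L2 powr (\<sigma>2 - \<sigma>2')) * (ennreal (weight \<sigma>1 \<sigma>2' x) * ?q)"
        by (simp add: ennreal_mult weight_def mult.assoc)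
      also have "\<dots> \<le> ennreal (L2 powr (\<sigma>2 - \<sigma>2')) * ennreal (K * G1 * H2)"
        using \<sigma> assms(12) H2 G1(1,2) order_trans[OF scale_integral_mono[OF sub] H2(2), of L2]
        by (intro mult_left_mono Q) auto
      also have "\<dots> = ennreal (K * G1 * H2 * L2 powr (\<sigma>2 - \<sigma>2'))"
        using nn by (simp add: ennreal_mult mult.commute)
      also have "\<dots> \<le> ennreal (D * L2 powr (\<sigma>2 - \<sigma>2'))"
        by (intro ennreal_leI D) simp
      finally show ?thesis .
    qed
  qed
qed

end
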